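(* Let $q\equiv1\pmod{24}$ be a prime power, let $\eta\in\widehat{\mathbb F_q^\times}$ have order $24$, and let $x\in\mathbb F_q$ with $x\neq-\tfrac18,\tfrac14$. Then $${}_2\mathbb F_1\!\left[\begin{matrix}\overline\eta&\eta^7\\&\eta^{18}\end{matrix};\frac{-27x}{(1-4x)^3}\right]=\frac{1+\phi(1-x)}2\left(\eta^3\!\left(\frac{(1+\sqrt{1-x})^2}{4(1-4x)}\right)+\eta^3\!\left(\frac{(1-\sqrt{1-x})^2}{4(1-4x)}\right)\right).$$
   Context: $\mathbb F_q$ is a finite field with $q$ elements, $q$ a power of an odd prime $p$. $\widehat{\mathbb F_q^\times}$ is the group of multiplicative characters $\chi:\mathbb F_q^\times\to\mathbb C^\times$; every character, including the trivial character $\varepsilon$, is extended to $\mathbb F_q$ by $\chi(0)=0$. $\phi$ is the quadratic character, $\overline\chi$ denotes the complex-conjugate (inverse) character, and products/powers of characters are pointwise. Jacobi sum: $J(A,B)=\sum_{x\in\mathbb F_q}A(x)B(1-x)$. Period function: ${}_2\mathbb P_1\!\left[\begin{matrix}A&B\\&C\end{matrix};\lambda\right]=\sum_{y\in\mathbb F_q}B(y)\,\overline BC(1-y)\,\overline A(1-\lambda y)$; normalized function ${}_2\mathbb F_1\!\left[\begin{matrix}A&B\\&C\end{matrix};\lambda\right]=\frac{1}{J(B,C\overline B)}\,{}_2\mathbb P_1\!\left[\begin{matrix}A&B\\&C\end{matrix};\lambda\right]$. For $w\in\mathbb F_q$, $\sqrt w$ denotes either square root of $w$ in $\mathbb F_q$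 when one exists (the expressions do not depend on the choice); when $w$ is a nonzero non-square the prefactor $(1+\phi(w))/2$ is $0$ and the whole right-hand side is interpreted as $0$. *)

theory Defs
  imports Complex_Main
begin

definition mult_char :: "('a::{finite,field} \<Rightarrow> complex) \<Rightarrow> bool" where
  "mult_char chi \<longleftrightarrow> chi 0 = 0 \<and> chi 1 = 1 \<and>
     (\<forall>x y. x \<noteq> 0 \<longrightarrow> y \<noteq> 0 \<longrightarrow> chi (x * y) = chi x * chi y)"

definition char_pow :: "('a::{finite,field} \<Rightarrow> complex) \<Rightarrow> nat \<Rightarrow> 'a \<Rightarrow> complex" where
  "char_pow chi n = (\<lambda>x. if x = 0 then 0 else (chi x) ^ n)"

definition char_conj :: "('a::{finite,field} \<Rightarrow> complex) \<Rightarrow> 'a \<Rightarrow> complex" where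
  "char_conj chi = (\<lambda>x. cnj (chi x))"

definition char_mult :: "('a::{finite,field} \<Rightarrow> complex) \<Rightarrow> ('a \<Rightarrow> complex) \<Rightarrow> 'a \<Rightarrow> complex" where
  "char_mult A B = (\<lambda>x. A x * B x)"

definition char_order :: "('a::{finite,field} \<Rightarrow> complex) \<Rightarrow> nat \<Rightarrow> bool" where
  "char_order chi n \<longleftrightarrow> 0 < n \<and> (\<forall>x. x \<noteq> 0 \<longrightarrow> chi x ^ n = 1) \<and>
     (\<forall>k. 0 < k \<longrightarrow> k < n \<longrightarrow> (\<exists>x. x \<noteq> 0 \<and> chi x ^ k \<noteq> 1))"

definition qchar :: "'a::{finite,field} \<Rightarrow> complex" where
  "qchar x = (if x = 0 then 0 else if (\<exists>y. y ^ 2 = x) then 1 else -1)"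

definition jacobi :: "('a::{finite,field} \<Rightarrow> complex) \<Rightarrow> ('a \<Rightarrow> complex) \<Rightarrow> complex" where
  "jacobi A B = (\<Sum>x\<in>UNIV. A x * B (1 - x))"

definition P21 :: "('a::{finite,field} \<Rightarrow> complex) \<Rightarrow> ('a \<Rightarrow> complex) \<Rightarrow> ('a \<Rightarrow> complex) \<Rightarrow> 'a \<Rightarrow> complex" where
  "P21 A B C lam = (\<Sum>y\<in>UNIV. B y * char_mult (char_conj B) C (1 - y) * char_conj A (1 - lam * y))"

definition F21 :: "('a::{finite,field} \<Rightarrow> complex) \<Rightarrow> ('a \<Rightarrow> complex) \<Rightarrow> ('a \<Rightarrow> complex) \<Rightarrow> 'a \<Rightarrow> complex" where
  "F21 A B C lam = P21 A B C lam / jacobi B (char_mult (char_conj B) C)"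

end

theory Submission
  imports Defs "HOL-Computational_Algebra.Polynomial"
begin

text \<open>
  Write \<open>\<alpha> = \<eta>\<^sup>3\<close>, \<open>\<phi> = \<eta>\<^sup>1\<^sup>2\<close> and let \<open>P(\<lambda>)\<close> be the period function. Up to a Jacobi sum, \<open>P(\<lambda>)\<close> is
  \<open>\<Sum> \<eta>\<^sup>-\<^sup>1(c) \<eta>\<^sup>7(d) \<phi>(1 + c + d + \<lambda>cd)\<close> over all \<open>c, d\<close>. Here \<open>\<eta>\<^sup>-\<^sup>1(c) \<eta>\<^sup>7(d) = \<eta>\<^sup>-\<^sup>1(cd) \<eta>\<^sup>8(d)\<close> with \<open>\<eta>\<^sup>8\<close>
  cubic, and for fixed \<open>t = cd\<close> and \<open>z = c + d\<close> the values \<open>\<eta>\<^sup>8(td)\<close> count, by Cardano's formula, the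
  roots of \<open>x\<^sup>3 = t(z + 3x)\<close>. This turns the double sum into
  \<open>\<Sum>\<^sub>t \<alpha>(t) \<Sum>\<^sub>x \<phi>(x\<^sup>3 - 3tx + t + \<lambda>t\<^sup>2)\<close>, a weighted count of points on elliptic curves. For
  \<open>\<lambda> = -27x/(1 - 4x)\<^sup>3\<close> these curves are the Jacobians of the quartics
  \<open>v\<^sup>2 = -y\<^sup>4 + y\<^sup>3 + Tx(y - x)\<close>, \<open>T = \<lambda>t\<close>, which have a rational point because \<open>-1\<close> is a square;
  so the point counts agree. The quartic is linear in \<open>T\<close>, hence the sum over \<open>T\<close>
  is a Jacobi sum times \<open>\<Sum>\<^sub>y \<alpha>\<^sup>-\<^sup>1(y(y - x)) \<alpha>\<^sup>-\<^sup>3(1 - y)\<close>. Grouping \<open>y\<close> by the value of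
  \<open>y(y - x)/(1 - y)\<close> pairs arguments \<open>1 - y\<close> with product \<open>1 - x\<close>, which
  gives the two terms in \<open>\<surd>(1 - x)\<close>. The constant is found by the same computation at \<open>\<lambda> = 0\<close>.
\<close>

section \<open>Sums over a finite field and multiplicative characters\<close>

lemma sum_affine:
  fixes F :: "'a::{finite,field} \<Rightarrow> 'b::comm_monoid_add"
  assumes "a \<noteq> 0"
  shows "(\<Sum>x\<in>UNIV. F (a * x + b)) = (\<Sum>x\<in>UNIV. F x)"
  by (rule sum.reindex_bij_witness[where i = "\<lambda>y. (y - b) / a" and j = "\<lambda>x. a * x + b"])
     (use assms in auto)

lemma sum_level:
  fixes g :: "'a::finite \<Rightarrow> 'b::finite" and F :: "'b \<Rightarrow> 'c::comm_semiring_1"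
  shows "(\<Sum>x\<in>UNIV. F (g x) * G x) = (\<Sum>t\<in>UNIV. F t * (\<Sum>x | g x = t. G x))"
proof -
  have "(\<Sum>t\<in>UNIV. F t * (\<Sum>x | g x = t. G x)) = (\<Sum>t\<in>UNIV. \<Sum>x | x \<in> UNIV \<and> g x = t. F (g x) * G x)"
    by (auto simp: sum_distrib_left intro!: sum.cong)
  also have "\<dots> = (\<Sum>x\<in>UNIV. F (g x) * G x)"
    by (rule sum.group) auto
  finally show ?thesis ..
qed

lemma sum_card_swap:
  fixes R :: "'a::finite \<Rightarrow> 'b::finite \<Rightarrow> bool"
  shows "(\<Sum>x\<in>UNIV. of_nat (card {y. R x y}) :: 'c::comm_semiring_1) = (\<Sum>y\<in>UNIV. of_nat (card {x. R x y}))"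
proof -
  have "(of_nat (card {y. R x y}) :: 'c) = (\<Sum>y\<in>UNIV. if R x y then 1 else 0)" for x
    by (simp flip: sum.inter_filter)
  moreover have "(of_nat (card {x. R x y}) :: 'c) = (\<Sum>x\<in>UNIV. if R x y then 1 else 0)" for y
    by (simp flip: sum.inter_filter)
  ultimately show ?thesis
    using sum.swap by simp
qed

lemma mult_char_0: "mult_char A \<Longrightarrow> A 0 = 0"
  and mult_char_1: "mult_char A \<Longrightarrow> A 1 = 1"
  by (simp_all add: mult_char_def)

lemma mult_char_mult: "mult_char A \<Longrightarrow> A (x * y) = A x * A y"
  by (cases "x = 0 \<or> y = 0") (auto simp: mult_char_def)

lemma mult_char_inverse:
  assumes "mult_char A"
  shows "A (inverse x) = inverse (A x)"
proof (cases "x = 0")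
  case False
  have "A x * A (inverse x) = 1"
    using False mult_char_mult[OF assms, of x "inverse x"] mult_char_1[OF assms] by simp
  then show ?thesis by (metis inverse_unique)
qed (use assms in \<open>simp add: mult_char_0\<close>)

lemma mult_char_divide: "mult_char A \<Longrightarrow> A (x / y) = A x / A y"
  by (simp add: divide_inverse mult_char_mult mult_char_inverse)

lemma mult_char_power: "mult_char A \<Longrightarrow> 0 < n \<Longrightarrow> A (x ^ n) = A x ^ n"
proof (induction n)
  case (Suc n)
  then show ?case by (cases n) (auto simp: mult_char_mult)
qed simp

lemma mult_char_eq_0_iff: "mult_char A \<Longrightarrow> A x = 0 \<longleftrightarrow> x = 0"
  by (metis mult_char_0 mult_char_1 mult_char_mult mult_zero_left right_inverse zero_neq_one)

lemma mult_char_pow: "mult_char A \<Longrightarrow> 0 < n \<Longrightarrow> mult_char (\<lambda>x. A x ^ n)"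
  by (simp add: mult_char_def power_mult_distrib)

lemma mult_char_sum_eq_0:
  assumes "mult_char A" "A g \<noteq> 1" "g \<noteq> 0"
  shows "(\<Sum>x\<in>UNIV. A x) = 0"
proof -
  have "(\<Sum>x\<in>UNIV. A x) = (\<Sum>x\<in>UNIV. A (g * x + 0))"
    by (rule sum_affine[symmetric, OF assms(3)])
  also have "\<dots> = A g * (\<Sum>x\<in>UNIV. A x)"
    by (simp add: mult_char_mult[OF assms(1)] sum_distrib_left)
  finally show ?thesis using assms(2) by simp
qed

text \<open>Both sides vanish when \<open>p = 0\<close> or \<open>r = 0\<close>, the right one because \<open>A 0 = 0\<close>
  and \<open>p / 0 = 0\<close>.\<close>

lemma sum_linear_jacobi:
  assumes A: "mult_char A" and B: "mult_char B"
    and A0: "(\<Sum>x\<in>UNIV. A x) = 0" and AB0: "(\<Sum>x\<in>UNIV. A x * B x) = 0"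
  shows "(\<Sum>c\<in>UNIV. A c * B (p + c * r)) = A (- p / r) * B p * jacobi A B"
proof -
  consider "r = 0" | "p = 0" "r \<noteq> 0" | "p \<noteq> 0" "r \<noteq> 0" by blast
  then show ?thesis
  proof cases
    case 1
    then show ?thesis using A0 by (simp add: mult_char_0[OF A] flip: sum_distrib_right)
  next
    case 2
    have "(\<Sum>c\<in>UNIV. A c * B (p + c * r)) = (\<Sum>c\<in>UNIV. A c * B c) * B r"
      using 2 by (simp add: mult_char_mult[OF B] sum_distrib_right mult.assoc)
    then show ?thesis using AB0 2 by (simp add: mult_char_0[OF A])
  next
    case 3
    have "(\<Sum>c\<in>UNIV. A c * B (p + c * r))
        = (\<Sum>x\<in>UNIV. A (- p / r * x + 0) * B (p + (- p / r * x + 0) * r))"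
      by (rule sum_affine[symmetric]) (use 3 in auto)
    also have "\<dots> = (\<Sum>x\<in>UNIV. A (- p / r) * B p * (A x * B (1 - x)))"
    proof (rule sum.cong[OF refl])
      fix x
      have "p + (- p / r * x + 0) * r = p * (1 - x)"
        using 3 by (simp add: field_simps)
      moreover have "A (- p / r * x + 0) = A (- p / r) * A x"
        by (simp only: mult_char_mult[OF A] add_0_right)
      ultimately show "A (- p / r * x + 0) * B (p + (- p / r * x + 0) * r) = A (- p / r) * B p * (A x * B (1 - x))"
        by (simp only: mult_char_mult[OF B] ac_simps)
    qed
    finally show ?thesis by (simp add: jacobi_def sum_distrib_left)
  qed
qed

lemma card_poly_eq_0_le:
  fixes p :: "'a::field poly"
  assumes "p \<noteq> 0" "degree p \<le> n" "\<And>x. P x \<Longrightarrow> poly p x = 0"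
  shows "card {x. P x} \<le> n"
proof -
  have "card {x. P x} \<le> card {x. poly p x = 0}"
    by (rule card_mono) (use assms poly_roots_finite in auto)
  also have "\<dots> \<le> n"
    using card_poly_roots_bound[OF assms(1)] assms(2) by linarith
  finally show ?thesis .
qed

lemma card_power_eq_le:
  fixes w :: "'a::field"
  assumes "0 < n"
  shows "card {x. x ^ n = w} \<le> n"
proof (rule card_poly_eq_0_le[where p = "monom 1 n + [:- w:]"])
  have "degree (monom 1 n + [:- w:]) = n"
    using assms by (subst degree_add_eq_left) (simp_all add: degree_monom_eq)
  then show "monom 1 n + [:- w:] \<noteq> 0" "degree (monom 1 n + [:- w:]) \<le> n"
    using assms by auto
qed (simp add: poly_monom)

section \<open>A character of order 24, power residues and square roots\<close>

locale order24_char =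
  fixes \<eta> :: "'a::{finite,field} \<Rightarrow> complex"
  assumes char: "mult_char \<eta>" and order: "char_order \<eta> 24"
begin

lemmas eta_mult = mult_char_mult[OF char]
  and eta_divide = mult_char_divide[OF char]
  and eta_power = mult_char_power[OF char]
  and eta_0 [simp] = mult_char_0[OF char]
  and eta_1 [simp] = mult_char_1[OF char]
  and eta_eq_0_iff [simp] = mult_char_eq_0_iff[OF char]

lemma eta_pow_24: "x \<noteq> 0 \<Longrightarrow> \<eta> x ^ 24 = 1"
  using order by (simp add: char_order_def)

lemma eta_pow_mod: "x \<noteq> 0 \<Longrightarrow> \<eta> x ^ n = \<eta> x ^ (n mod 24)"
  by (metis eta_pow_24 mult_div_mod_eq mult.left_neutral power_add power_mult power_one)

lemma eta_pow_sum:
  assumes "n mod 24 \<noteq> 0"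
  shows "(\<Sum>x\<in>UNIV. \<eta> x ^ n) = 0"
proof -
  have "0 < n mod 24" "n mod 24 < 24" using assms by auto
  then obtain g where g: "g \<noteq> 0" "\<eta> g ^ (n mod 24) \<noteq> 1"
    using order unfolding char_order_def by blast
  then have "\<eta> g ^ n \<noteq> 1"
    by (metis eta_pow_mod)
  moreover have "0 < n" using assms by (auto intro: Nat.gr0I)
  ultimately show ?thesis
    using mult_char_sum_eq_0[OF mult_char_pow[OF char]] g(1) by blast
qed

text \<open>Orthogonality: summing \<open>(\<eta> w ^ k) ^ j\<close> over \<open>j < n\<close>
  detects the kernel of the \<open>k\<close>-th power of \<open>\<eta>\<close>. Summed over
  \<open>w\<close> first, only \<open>j = 0\<close> survives, because \<open>0 < k * j < 24\<close>
  for the other \<open>j\<close> and the order is exactly 24.\<close>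

lemma card_kernel:
  assumes nk: "n * k = 24"
  shows "n * card {w. w \<noteq> 0 \<and> \<eta> w ^ k = 1} = card {w::'a. w \<noteq> 0}"
proof -
  let ?U = "{w::'a. w \<noteq> 0}"
  have n: "0 < n" and k: "0 < k" using nk by (auto intro: Nat.gr0I)
  have inner: "(\<Sum>j<n. (\<eta> w ^ k) ^ j) = (if \<eta> w ^ k = 1 then of_nat n else 0)" if "w \<noteq> 0" for w
  proof (cases "\<eta> w ^ k = 1")
    case False
    have "(\<eta> w ^ k) ^ n = 1"
      using eta_pow_24[OF that] nk by (simp add: mult.commute flip: power_mult)
    then show ?thesis using False geometric_sum[of "\<eta> w ^ k" n] by simp
  qed simp
  have "of_nat (n * card {w. w \<noteq> 0 \<and> \<eta> w ^ k = 1}) = (\<Sum>w\<in>?U. if \<eta> w ^ k = 1 then of_nat n else (0::complex))"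
    by (simp flip: sum.inter_filter add: mult.commute)
  also have "\<dots> = (\<Sum>w\<in>?U. \<Sum>j<n. (\<eta> w ^ k) ^ j)"
    by (rule sum.cong) (auto simp: inner)
  also have "\<dots> = (\<Sum>j<n. \<Sum>w\<in>?U. (\<eta> w ^ k) ^ j)"
    by (rule sum.swap)
  also have "\<dots> = (\<Sum>j<n. if j = 0 then of_nat (card ?U) else 0)"
  proof (rule sum.cong[OF refl])
    fix j assume j: "j \<in> {..<n}"
    show "(\<Sum>w\<in>?U. (\<eta> w ^ k) ^ j) = (if j = 0 then of_nat (card ?U) else 0)"
    proof (cases "j = 0")
      case False
      have kj: "0 < k * j" "k * j < 24"
        using False k j nk mult_strict_left_mono[of j n k] by (auto simp: mult.commute)
      have "(\<Sum>w\<in>?U. (\<eta> w ^ k) ^ j) = (\<Sum>w\<in>UNIV. \<eta> w ^ (k * j))"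
        using kj by (intro sum.mono_neutral_cong_left) (auto simp: power_mult power_0_left)
      also have "\<dots> = 0"
        using kj by (intro eta_pow_sum) simp
      finally show ?thesis using False by simp
    qed simp
  qed
  also have "\<dots> = of_nat (card ?U)"
    using n by (simp add: sum.delta)
  finally show ?thesis using of_nat_eq_iff by blast
qed

text \<open>The \<open>n\<close>-th power map sends nonzero elements into the kernel counted by
  \<open>card_kernel\<close>, with fibres of size at most \<open>n\<close>. The totals agree only if
  every fibre over the kernel has exactly \<open>n\<close> elements.\<close>

lemma card_nth_roots:
  assumes nk: "n * k = 24" and w: "w \<noteq> 0"
  shows "card {x. x ^ n = w} = (if \<eta> w ^ k = 1 then n else 0)"
proof (cases "\<eta> w ^ k = 1")
  case True
  let ?K = "{w. w \<noteq> 0 \<and> \<eta> w ^ k = 1}"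
  have n: "0 < n" using nk by (auto intro: Nat.gr0I)
  have K: "x ^ n \<in> ?K" if "x \<noteq> 0" for x
    using that eta_pow_24[OF that] nk n by (simp add: eta_power flip: power_mult)
  have "(\<Sum>v\<in>?K. n) = card {w::'a. w \<noteq> 0}"
    using card_kernel[OF nk] by (simp add: mult.commute)
  also have "\<dots> = (\<Sum>v\<in>?K. card {x. x \<in> {w::'a. w \<noteq> 0} \<and> x ^ n = v})"
    using sum.group[of "{w::'a. w \<noteq> 0}" ?K "\<lambda>x. x ^ n" "\<lambda>_. 1::nat"] K by (simp add: image_subset_iff)
  also have "\<dots> = (\<Sum>v\<in>?K. card {x. x ^ n = v})"
    using n by (intro sum.cong refl arg_cong[of _ _ card]) auto
  finally have eq: "(\<Sum>v\<in>?K. card {x. x ^ n = v}) = (\<Sum>v\<in>?K. n)" ..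
  have "\<And>v. v \<in> ?K \<Longrightarrow> card {x. x ^ n = v} = n"
  proof (rule ccontr)
    fix v assume v: "v \<in> ?K" "card {x. x ^ n = v} \<noteq> n"
    then have "(\<Sum>v\<in>?K. card {x. x ^ n = v}) < (\<Sum>v\<in>?K. n)"
      using card_power_eq_le[OF n]
      by (intro sum_strict_mono_ex1) (auto intro!: exI[of _ v] simp: order_less_le)
    then show False using eq by simp
  qed
  then show ?thesis using True w by simp
next
  case False
  have "{x. x ^ n = w} = {}"
  proof -
    have "\<eta> w ^ k = 1" if "x ^ n = w" for x
    proof -
      have "x \<noteq> 0" "0 < n" using that w nk by (auto intro: Nat.gr0I simp: power_0_left split: if_splits)
      then show ?thesis
        using that eta_pow_24[of x] nk by (auto simp: eta_power simp flip: power_mult)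
    qed
    then show ?thesis using False by auto
  qed
  then show ?thesis using False by simp
qed

text \<open>This is the quadratic character, by \<open>phi_eq_1_iff\<close>. Written as a power of
  \<open>\<eta>\<close>, it merges with the other characters by adding exponents.\<close>

abbreviation \<phi> :: "'a \<Rightarrow> complex" where "\<phi> x \<equiv> \<eta> x ^ 12"

lemma phi_mult: "\<phi> (x * y) = \<phi> x * \<phi> y"
  by (simp add: eta_mult power_mult_distrib)

lemma phi_cases:
  assumes "x \<noteq> 0"
  shows "\<phi> x = 1 \<or> \<phi> x = - 1"
proof -
  have "(\<phi> x) ^ 2 = 1"
    using eta_pow_24[OF assms] by (simp flip: power_mult)
  then show ?thesis by (simp only: power2_eq_1_iff)
qed

lemma phi_eq_1_iff:
  assumes "x \<noteq> 0"
  shows "\<phi> x = 1 \<longleftrightarrow> (\<exists>y. y ^ 2 = x)"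
proof -
  have "(\<exists>y. y ^ 2 = x) \<longleftrightarrow> card {y. y ^ 2 = x} \<noteq> 0" by simp
  then show ?thesis using card_nth_roots[of 2 12 x] assms by simp
qed

lemma phi_square: "x \<noteq> 0 \<Longrightarrow> \<phi> (x ^ 2) = 1"
  using phi_eq_1_iff[of "x ^ 2"] by auto

text \<open>In characteristic 2 the equation \<open>x ^ 2 = 1\<close> would have one root, whereas
  \<open>card_nth_roots\<close> gives two.\<close>

lemma two_neq_0: "(2::'a) \<noteq> 0"
proof
  assume "(2::'a) = 0"
  then have "x = 1" if "x ^ 2 = 1" for x :: 'a
    using that by (metis add_eq_0_iff2 one_add_one power2_eq_1_iff)
  then have "{x::'a. x ^ 2 = 1} = {1}" by auto
  then show False using card_nth_roots[of 2 12 1] by simp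
qed

lemma four_neq_0: "(4::'a) \<noteq> 0"
  using two_neq_0 by (metis mult_2 mult_eq_0_iff numeral_Bit0)

lemma eight_neq_0: "(8::'a) \<noteq> 0"
  using four_neq_0 by (metis mult_2 mult_eq_0_iff numeral_Bit0)

lemma cube_root_unity: obtains \<omega> :: 'a where "\<omega> \<noteq> 1" "\<omega> ^ 2 + \<omega> + 1 = 0"
proof -
  have "card {x::'a. x ^ 3 = 1} = 3"
    using card_nth_roots[of 3 8 1] by simp
  then have "\<not> {x::'a. x ^ 3 = 1} \<subseteq> {1}"
    using card_mono[of "{1::'a}" "{x. x ^ 3 = 1}"] by auto
  then obtain \<omega> :: 'a where w: "\<omega> ^ 3 = 1" "\<omega> \<noteq> 1" by auto
  have "(\<omega> - 1) * (\<omega> ^ 2 + \<omega> + 1) = 0"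
    using w(1) by (simp add: algebra_simps power2_eq_square power3_eq_cube)
  then show thesis using that w(2) by auto
qed

text \<open>In characteristic 3, \<open>\<omega> ^ 2 + \<omega> + 1\<close> equals
  \<open>(\<omega> - 1) ^ 2\<close>, which forces \<open>\<omega> = 1\<close>.\<close>

lemma three_neq_0: "(3::'a) \<noteq> 0"
proof
  assume 3: "(3::'a) = 0"
  obtain \<omega> :: 'a where w: "\<omega> \<noteq> 1" "\<omega> ^ 2 + \<omega> + 1 = 0" by (rule cube_root_unity)
  have "(\<omega> - 1) ^ 2 = \<omega> ^ 2 + \<omega> + 1 - 3 * \<omega>"
    by (simp add: power2_eq_square algebra_simps)
  then show False using w 3 by simp
qed

text \<open>The discriminant of \<open>x ^ 3 - 3 * t * x - t * z\<close> is
  \<open>- 27 * t ^ 2\<close> times that of the Cardano resolvent \<open>d * (z - d) = t\<close>;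
  this lemma makes that factor a square.\<close>

lemma minus_three_square: obtains r :: 'a where "r ^ 2 = - 3"
proof -
  obtain \<omega> :: 'a where w: "\<omega> ^ 2 + \<omega> + 1 = 0" by (rule cube_root_unity)
  have "(2 * \<omega> + 1) ^ 2 = 4 * (\<omega> ^ 2 + \<omega> + 1) - 3"
    by (simp add: power2_eq_square algebra_simps)
  then show thesis using that w by simp
qed

lemma phi_minus_1: "\<phi> (- 1) = 1"
proof -
  have "\<eta> (- 1) ^ 2 = 1" using eta_power[of 2 "- 1"] by simp
  then show ?thesis using power_mult[of "\<eta> (- 1)" 2 6] by simp
qed

lemma minus_1_square: obtains r :: 'a where "r ^ 2 = - 1"
  using phi_eq_1_iff[of "- 1"] phi_minus_1 by auto

lemma card_sqrt: "of_nat (card {y. y ^ 2 = w}) = 1 + \<phi> w"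
proof (cases "w = 0")
  case False
  then show ?thesis
    using card_nth_roots[of 2 12 w] phi_cases[of w] by auto
qed simp

lemma card_quadratic:
  assumes "a \<noteq> 0"
  shows "of_nat (card {y. a * y ^ 2 + b * y + c = 0}) = 1 + \<phi> (b ^ 2 - 4 * a * c)"
proof -
  have *: "a * y ^ 2 + b * y + c = 0 \<longleftrightarrow> (2 * a * y + b) ^ 2 = b ^ 2 - 4 * a * c" for y
  proof -
    have "(2 * a * y + b) ^ 2 - (b ^ 2 - 4 * a * c) = 4 * a * (a * y ^ 2 + b * y + c)"
      by (simp add: power2_eq_square algebra_simps)
    then show ?thesis using four_neq_0 assms
      by (metis eq_iff_diff_eq_0 mult_eq_0_iff)
  qed
  define D where "D = b ^ 2 - 4 * a * c"
  have "bij_betw (\<lambda>y. 2 * a * y + b) {y. (2 * a * y + b) ^ 2 = D} {z. z ^ 2 = D}"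
    by (rule bij_betw_byWitness[where f' = "\<lambda>z. (z - b) / (2 * a)"]) (use assms two_neq_0 in auto)
  then have "bij_betw (\<lambda>y. 2 * a * y + b) {y. a * y ^ 2 + b * y + c = 0} {z. z ^ 2 = b ^ 2 - 4 * a * c}"
    by (simp only: * D_def)
  then show ?thesis using card_sqrt[of "b ^ 2 - 4 * a * c"] by (simp add: bij_betw_same_card)
qed

text \<open>Positivity of \<open>n\<close> matters at \<open>x = 0\<close>, where both powers must
  vanish.\<close>

lemma eta_pow_add_24: "0 < n \<Longrightarrow> \<eta> x ^ (n + 24) = \<eta> x ^ n"
  using eta_pow_24[of x] by (cases "x = 0") (simp_all add: power_add)

lemma inverse_eta_pow: "0 < n \<Longrightarrow> n < 24 \<Longrightarrow> inverse (\<eta> x ^ n) = \<eta> x ^ (24 - n)"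
proof (cases "x = 0")
  case False
  assume "0 < n" "n < 24"
  then have "\<eta> x ^ n * \<eta> x ^ (24 - n) = 1"
    using eta_pow_24[OF False] by (simp flip: power_add)
  then show ?thesis by (rule inverse_unique)
qed (simp add: power_0_left)

lemma eta_minus_1_sq: "\<eta> (- 1) ^ 2 = 1"
  using eta_power[of 2 "- 1"] by simp

section \<open>Cardano's formula and the cubic character\<close>

lemma eta_cube_pow_8: "x \<noteq> 0 \<Longrightarrow> \<eta> (x ^ 3) ^ 8 = 1"
  using eta_pow_24 by (simp add: eta_power flip: power_mult)

text \<open>Cardano: a root \<open>x\<close> of \<open>x\<^sup>3 - 3tx = tz\<close> has the form \<open>u + t/u\<close>, where \<open>u\<^sup>3 = td\<close> and \<open>d\<close> is
  a root of \<open>d(z - d) = t\<close>.\<close>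

lemma card_cubic_roots_le:
  assumes t: "t \<noteq> 0"
  shows "\<exists>r::int. (\<Sum>d | d * (z - d) = t. \<eta> (t * d) ^ 8) = of_int r
           \<and> int (card {x. x ^ 3 = t * (z + 3 * x)}) - 1 \<le> r"
proof -
  let ?R = "{x. x ^ 3 = t * (z + 3 * x)}"
  \<comment> \<open>With \<open>x = u + v\<close>, \<open>u * v = t\<close>, the left side is
    \<open>(u ^ 3 - v ^ 3) ^ 2\<close>. So \<open>x ^ 2 - 4 * t\<close> and
    \<open>z ^ 2 - 4 * t\<close> agree up to squares, except where a factor vanishes.\<close>
  have disc: "(x ^ 2 - 4 * t) * (x ^ 2 - t) ^ 2 = t ^ 2 * (z ^ 2 - 4 * t)" if "x \<in> ?R" for x
  proof -
    have "x ^ 3 - 3 * t * x = t * z" using that by (simp add: algebra_simps)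
    moreover have "(x ^ 2 - 4 * t) * (x ^ 2 - t) ^ 2 = (x ^ 3 - 3 * t * x) ^ 2 - 4 * t ^ 3"
      by algebra
    ultimately show ?thesis by (simp add: algebra_simps power2_eq_square power3_eq_cube)
  qed
  show ?thesis
  proof (cases "\<exists>d. d * (z - d) = t")
    case False
    have "card ?R \<le> Suc 0"
    proof (rule ccontr)
      \<comment> \<open>Two distinct roots make \<open>- 3 * (x ^ 2 - 4 * t)\<close> a square, hence
        \<open>x ^ 2 - 4 * t\<close> as well. By \<open>disc\<close> the resolvent then has a square
        discriminant and a root \<open>d\<close>, which is excluded here.\<close>
      assume "\<not> card ?R \<le> Suc 0"
      then obtain x y where xy: "x \<in> ?R" "y \<in> ?R" "x \<noteq> y"
        using card_le_Suc0_iff_eq[of ?R] by auto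
      have "(x - y) * (x ^ 2 + x * y + y ^ 2 - 3 * t) = (x ^ 3 - 3 * t * x) - (y ^ 3 - 3 * t * y)"
        by algebra
      also have "\<dots> = 0" using xy(1,2) by (simp add: algebra_simps)
      finally have quad: "x ^ 2 + x * y + y ^ 2 - 3 * t = 0" using xy(3) by simp
      obtain r :: 'a where r: "r ^ 2 = - 3" by (rule minus_three_square)
      have r0: "r \<noteq> 0" using r three_neq_0 by auto
      have "(2 * y + x) ^ 2 = r ^ 2 * (x ^ 2 - 4 * t)"
        using quad unfolding r by algebra
      then have "x ^ 2 - 4 * t = ((2 * y + x) / r) ^ 2"
        using r0 by (simp add: power_divide)
      then have "t ^ 2 * (z ^ 2 - 4 * t) = ((2 * y + x) / r * (x ^ 2 - t)) ^ 2"
        using disc[OF xy(1)] by (simp only: power_mult_distrib)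
      then have "z ^ 2 - 4 * t = ((2 * y + x) / r * (x ^ 2 - t) / t) ^ 2"
        using t by (subst power_divide) (simp add: eq_divide_eq mult.commute)
      then obtain h where h: "z ^ 2 - 4 * t = h ^ 2" by blast
      have "4 * ((z + h) / 2 * (z - (z + h) / 2)) = z ^ 2 - h ^ 2"
        using two_neq_0 four_neq_0 by (simp add: field_simps power2_eq_square)
      also have "\<dots> = 4 * t" using h by (simp add: algebra_simps)
      finally have "(z + h) / 2 * (z - (z + h) / 2) = t"
        using four_neq_0 by (metis mult_left_cancel)
      then show False using False by blast
    qed
    then show ?thesis using False by (intro exI[of _ 0]) simp
  next
    case True
    then obtain d where d: "d * (z - d) = t" by blast
    define e where "e = z - d"
    have te: "t = d * e" and z: "z = d + e" using d by (simp_all add: e_def)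
    have nz: "d \<noteq> 0" "e \<noteq> 0" using te t by auto
    have "x * (z - x) = t \<longleftrightarrow> x = d \<or> x = e" for x
    proof -
      have "x * (z - x) - t = (x - d) * (e - x)" unfolding te z by algebra
      then show ?thesis by (metis eq_iff_diff_eq_0 mult_eq_0_iff)
    qed
    then have set: "{x. x * (z - x) = t} = {d, e}" by auto
    show ?thesis
    proof (cases "d = e")
      case True
      \<comment> \<open>A double root of the resolvent: the cubic becomes
        \<open>(x + d) ^ 2 * (x - 2 * d)\<close>, and \<open>t * d = d ^ 3\<close> is a cube, so the
        single summand is 1.\<close>
      have "(x + d) * (x + d) * (x - 2 * d) = 0" if "x \<in> ?R" for x
      proof -
        have "x ^ 3 = d * d * (d + d + 3 * x)" using that unfolding te z True[symmetric] by simp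
        then show ?thesis by algebra
      qed
      then have "?R \<subseteq> {- d, 2 * d}" by (auto simp: add_eq_0_iff2)
      then have "card ?R \<le> card {- d, 2 * d}" by (intro card_mono) auto
      also have "\<dots> \<le> 2" by (simp add: card_insert_if)
      finally have "card ?R \<le> 2" .
      moreover have "\<eta> (t * d) ^ 8 = 1"
        using eta_cube_pow_8[OF nz(1)] te True by (simp add: power3_eq_cube)
      ultimately show ?thesis using True unfolding set by (intro exI[of _ 1]) simp
    next
      case False
      \<comment> \<open>\<open>c\<close> and \<open>c'\<close> are mutually inverse cube roots of
        unity, so their sum is 2 or -1. The bound then asks for at most three roots, respectively
        for none.\<close>
      define c c' where "c = \<eta> (t * d) ^ 8" and "c' = \<eta> (t * e) ^ 8"
      have sum: "(\<Sum>d | d * (z - d) = t. \<eta> (t * d) ^ 8) = c + c'"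
        using False unfolding set by (simp add: c_def c'_def)
      have "c ^ 3 = 1"
        using eta_pow_24[of "t * d"] t nz by (simp add: c_def flip: power_mult)
      moreover have "c * c' = 1"
      proof -
        have "c * c' = \<eta> (t ^ 3) ^ 8"
          by (simp add: c_def c'_def te eta_mult power_mult_distrib power3_eq_cube ac_simps)
        then show ?thesis using eta_cube_pow_8[OF t] by simp
      qed
      ultimately have c': "c' = c ^ 2"
        by (metis mult.assoc mult.commute mult_1 power2_eq_square power3_eq_cube)
      show ?thesis
      proof (cases "c = 1")
        case True
        have "card ?R \<le> 3"
        proof (rule card_poly_eq_0_le[where p = "[:- (t * z), - 3 * t, 0, 1:]"])
          show "poly [:- (t * z), - 3 * t, 0, 1:] x = 0" if "x ^ 3 = t * (z + 3 * x)" for x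
            using that by (simp add: algebra_simps power3_eq_cube)
        qed auto
        then show ?thesis using True c' sum by (intro exI[of _ 2]) simp
      next
        case c: False
        have "(c - 1) * (c ^ 2 + c + 1) = 0"
          using \<open>c ^ 3 = 1\<close> by (simp add: algebra_simps power2_eq_square power3_eq_cube)
        then have "c + c' = - 1"
          using c c' by (simp add: eq_neg_iff_add_eq_0 add.commute)
        moreover have "?R = {}"
        proof (rule ccontr)
          assume "?R \<noteq> {}"
          then obtain x where x: "x \<in> ?R" by blast
          have zz: "z ^ 2 - 4 * t = (d - e) ^ 2" unfolding te z by algebra
          have xt: "x ^ 2 \<noteq> t"
            using disc[OF x] zz t False by auto
          \<comment> \<open>Cardano backwards: \<open>h\<close> plays the role of
            \<open>u - v\<close>, solved from \<open>u ^ 3 - v ^ 3 = t * (d - e)\<close>. Then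
            \<open>u ^ 3\<close> and \<open>v ^ 3\<close> have the sum and product of
            \<open>t * d\<close> and \<open>t * e\<close>, which makes \<open>c\<close> or
            \<open>c'\<close> equal to 1.\<close>
          define h where "h = t * (d - e) / (x ^ 2 - t)"
          define u v where "u = (x + h) / 2" and "v = (x - h) / 2"
          have "h ^ 2 = x ^ 2 - 4 * t"
            using disc[OF x] xt unfolding zz h_def
            by (simp add: power_divide power_mult_distrib divide_eq_eq)
          moreover have "u * v * 4 = x ^ 2 - h ^ 2"
            using two_neq_0 four_neq_0 by (simp add: u_def v_def field_simps power2_eq_square)
          ultimately have "u * v * 4 = t * 4" by algebra
          then have uv: "u * v = t" using four_neq_0 by (metis mult_right_cancel)
          have xuv: "x = u + v" using two_neq_0 four_neq_0 by (simp add: u_def v_def field_simps)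
          have "x ^ 3 - 3 * t * x = t * d + t * e"
            using x z by (simp add: algebra_simps)
          moreover have "(u + v) ^ 3 - 3 * (u * v) * (u + v) = u ^ 3 + v ^ 3"
            by algebra
          ultimately have s3: "u ^ 3 + v ^ 3 = t * d + t * e"
            by (simp only: uv xuv)
          have "t * d * (t * e) = t ^ 3" by (simp add: te power3_eq_cube ac_simps)
          then have p3: "t * d * (t * e) = u ^ 3 * v ^ 3"
            by (simp only: uv[symmetric] power_mult_distrib)
          have "(u ^ 3 - t * d) * (u ^ 3 - t * e) = u ^ 3 * u ^ 3 - u ^ 3 * (t * d + t * e) + t * d * (t * e)"
            by (simp add: algebra_simps)
          also have "\<dots> = 0" unfolding s3[symmetric] p3 by (simp add: algebra_simps)
          finally have "(u ^ 3 - t * d) * (u ^ 3 - t * e) = 0" .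
          then have "u ^ 3 = t * d \<or> u ^ 3 = t * e" by auto
          moreover have "u \<noteq> 0" using uv t by auto
          ultimately have "c = 1 \<or> c' = 1"
            using eta_cube_pow_8[of u] unfolding c_def c'_def by auto
          then show False using c \<open>c * c' = 1\<close> by auto
        qed
        ultimately show ?thesis using sum by (intro exI[of _ "- 1"]) simp
      qed
    qed
  qed
qed

text \<open>The two sides have the same total over \<open>z\<close>, so the inequality is an equality.\<close>

lemma card_cubic_roots:
  assumes t: "t \<noteq> 0"
  shows "(\<Sum>d | d * (z - d) = t. \<eta> (t * d) ^ 8) = of_nat (card {x. x ^ 3 = t * (z + 3 * x)}) - 1"
proof -
  define N where "N z = card {x. x ^ 3 = t * (z + 3 * x)}" for z
  obtain r where r: "\<And>z. (\<Sum>d | d * (z - d) = t. \<eta> (t * d) ^ 8) = of_int (r z)"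
      "\<And>z. int (N z) - 1 \<le> r z"
    using card_cubic_roots_le[OF t] unfolding N_def by metis
  have "(\<Sum>z\<in>UNIV. of_int (r z)) = (\<Sum>z\<in>UNIV. 1 * (\<Sum>d | d + t / d = z. \<eta> (t * d) ^ 8))"
  proof (rule sum.cong[OF refl])
    fix z
    have "(\<Sum>d | d * (z - d) = t. \<eta> (t * d) ^ 8) = (\<Sum>d | d + t / d = z. \<eta> (t * d) ^ 8)"
    proof (rule sum.mono_neutral_cong_left)
      have iff: "d * (z - d) = t \<longleftrightarrow> d \<noteq> 0 \<and> d + t / d = z" for d
        using t by (cases "d = 0") (auto simp: field_simps)
      show "{d. d * (z - d) = t} \<subseteq> {d. d + t / d = z}"
        unfolding iff by auto
      show "\<forall>d\<in>{d. d + t / d = z} - {d. d * (z - d) = t}. \<eta> (t * d) ^ 8 = 0"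
        unfolding iff by auto
    qed auto
    then show "of_int (r z) = 1 * (\<Sum>d | d + t / d = z. \<eta> (t * d) ^ 8)" using r(1) by simp
  qed
  also have "\<dots> = (\<Sum>d\<in>UNIV. 1 * \<eta> (t * d) ^ 8)"
    by (rule sum_level[symmetric])
  also have "\<dots> = (\<Sum>d\<in>UNIV. \<eta> d ^ 8)"
    using sum_affine[OF t, of "\<lambda>d. \<eta> d ^ 8" 0] by simp
  also have "\<dots> = 0" by (rule eta_pow_sum) simp
  finally have "(\<Sum>z\<in>UNIV. r z) = 0"
    by (metis of_int_0_eq_iff of_int_sum)
  moreover have "(\<Sum>z\<in>UNIV. int (N z)) = int (card (UNIV :: 'a set))"
  proof -
    have "x ^ 3 = t * (z + 3 * x) \<longleftrightarrow> z = x ^ 3 / t - 3 * x" for x z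
      using t by (auto simp: field_simps)
    then have "card {z. x ^ 3 = t * (z + 3 * x)} = 1" for x by simp
    then show ?thesis
      using sum_card_swap[of "\<lambda>z x. x ^ 3 = t * (z + 3 * x)", where 'c = int] by (simp add: N_def)
  qed
  ultimately have "(\<Sum>z\<in>UNIV. r z - (int (N z) - 1)) = 0"
    by (simp add: sum_subtractf)
  then have "r z - (int (N z) - 1) = 0"
    using r(2) by (subst (asm) sum_nonneg_eq_0_iff) auto
  then show ?thesis using r(1)[of z] unfolding N_def by simp
qed

section \<open>From the period function to a family of cubics\<close>

abbreviation J :: "nat \<Rightarrow> complex" where
  "J n \<equiv> jacobi (\<lambda>x. \<eta> x ^ n) \<phi>"

lemma sum_linear_phi:
  assumes "0 < n" "n mod 24 \<noteq> 0" "(n + 12) mod 24 \<noteq> 0"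
  shows "(\<Sum>c\<in>UNIV. \<eta> c ^ n * \<phi> (p + c * r)) = \<eta> (- p / r) ^ n * \<phi> p * J n"
  by (rule sum_linear_jacobi)
     (use assms in \<open>auto intro!: mult_char_pow char eta_pow_sum simp flip: power_add\<close>)

text \<open>The period function for the parameters of the theorem: 11 is 18 - 7, and the last factor
  is the conjugate of the first parameter. \<open>F21_eq\<close> makes the link.\<close>

definition P :: "'a \<Rightarrow> complex" where
  "P l = (\<Sum>y\<in>UNIV. \<eta> y ^ 7 * \<eta> (1 - y) ^ 11 * \<eta> (1 - l * y))"

text \<open>Exponent 23 stands for the inverse of \<open>\<eta>\<close>. Inverses are written as
  positive powers throughout, so that they vanish at 0.\<close>

definition Q :: "'a \<Rightarrow> complex" where
  "Q l = (\<Sum>d\<in>UNIV. \<Sum>c\<in>UNIV. \<eta> c ^ 23 * \<eta> d ^ 7 * \<phi> (1 + c + d + l * c * d))"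

text \<open>The argument of \<phi> is \<open>(1 + d) + c * (1 + l * d)\<close>, so the sum over
  \<open>c\<close> is a Jacobi sum. The substitution \<open>d = - y\<close> then produces the
  integrand of \<open>P\<close>.\<close>

lemma Q_eq_P: "Q l = J 23 * P l"
proof -
  have "Q l = (\<Sum>d\<in>UNIV. \<eta> d ^ 7 * (\<Sum>c\<in>UNIV. \<eta> c ^ 23 * \<phi> ((1 + d) + c * (1 + l * d))))"
    unfolding Q_def by (simp add: sum_distrib_left algebra_simps)
  also have "\<dots> = (\<Sum>d\<in>UNIV. \<eta> d ^ 7 * (\<eta> (- (1 + d) / (1 + l * d)) ^ 23 * \<phi> (1 + d) * J 23))"
    by (simp add: sum_linear_phi)
  also have "\<dots> = (\<Sum>d\<in>UNIV. J 23 * \<eta> (- 1) ^ 23 * (\<eta> d ^ 7 * \<eta> (1 + d) ^ 11 * \<eta> (1 + l * d)))"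
  proof (rule sum.cong[OF refl])
    fix d
    have "\<eta> (- (1 + d) / (1 + l * d)) ^ 23 = \<eta> (- 1) ^ 23 * \<eta> (1 + d) ^ 23 * \<eta> (1 + l * d)"
    proof -
      have "- (1 + d) / (1 + l * d) = - 1 * (1 + d) / (1 + l * d)" by simp
      also have "\<eta> \<dots> ^ 23 = \<eta> (- 1) ^ 23 * \<eta> (1 + d) ^ 23 * inverse (\<eta> (1 + l * d) ^ 23)"
        by (simp only: eta_divide eta_mult power_mult_distrib divide_inverse power_inverse mult_char_inverse[OF char])
      finally show ?thesis by (simp add: inverse_eta_pow)
    qed
    moreover have "\<eta> (1 + d) ^ 23 * \<phi> (1 + d) = \<eta> (1 + d) ^ 11"
      using eta_pow_add_24[of 11 "1 + d"] by (simp flip: power_add)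
    ultimately show "\<eta> d ^ 7 * (\<eta> (- (1 + d) / (1 + l * d)) ^ 23 * \<phi> (1 + d) * J 23) =
        J 23 * \<eta> (- 1) ^ 23 * (\<eta> d ^ 7 * \<eta> (1 + d) ^ 11 * \<eta> (1 + l * d))"
      by (simp add: ac_simps)
  qed
  also have "\<dots> = (\<Sum>y\<in>UNIV. J 23 * \<eta> (- 1) ^ 23 * (\<eta> (- y) ^ 7 * \<eta> (1 - y) ^ 11 * \<eta> (1 - l * y)))"
    using sum_affine[of "- 1" "\<lambda>d. J 23 * \<eta> (- 1) ^ 23 * (\<eta> d ^ 7 * \<eta> (1 + d) ^ 11 * \<eta> (1 + l * d))" 0]
    by simp
  also have "\<dots> = (\<Sum>y\<in>UNIV. J 23 * (\<eta> y ^ 7 * \<eta> (1 - y) ^ 11 * \<eta> (1 - l * y)))"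
  proof (rule sum.cong[OF refl])
    fix y
    have "\<eta> (- y) ^ 7 = \<eta> (- 1) ^ 7 * \<eta> y ^ 7"
      using eta_mult[of "- 1" y] by (simp add: power_mult_distrib)
    moreover have "\<eta> (- 1) ^ 23 * \<eta> (- 1) ^ 7 = 1"
      using eta_minus_1_sq power_mult[of "\<eta> (- 1)" 2 15] by (simp flip: power_add)
    ultimately show "J 23 * \<eta> (- 1) ^ 23 * (\<eta> (- y) ^ 7 * \<eta> (1 - y) ^ 11 * \<eta> (1 - l * y)) =
        J 23 * (\<eta> y ^ 7 * \<eta> (1 - y) ^ 11 * \<eta> (1 - l * y))"
      by (simp add: mult.assoc mult.left_commute[of _ "\<eta> (- 1) ^ 7"])
  qed
  finally show ?thesis by (simp add: P_def sum_distrib_left)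
qed

lemma Q_eq_cubic: "Q l = (\<Sum>t\<in>UNIV. \<eta> t ^ 3 * (\<Sum>x\<in>UNIV. \<phi> (x ^ 3 - 3 * t * x + t + l * t ^ 2)))"
proof -
  let ?N = "\<lambda>t z. of_nat (card {x. x ^ 3 = t * (z + 3 * x)}) :: complex"
  have "Q l = (\<Sum>d\<in>UNIV. \<Sum>z\<in>UNIV. \<eta> (z - d) ^ 23 * \<eta> d ^ 7 * \<phi> (1 + (z - d) + d + l * (z - d) * d))"
    unfolding Q_def
  proof (rule sum.cong[OF refl])
    fix d
    show "(\<Sum>c\<in>UNIV. \<eta> c ^ 23 * \<eta> d ^ 7 * \<phi> (1 + c + d + l * c * d)) =
      (\<Sum>z\<in>UNIV. \<eta> (z - d) ^ 23 * \<eta> d ^ 7 * \<phi> (1 + (z - d) + d + l * (z - d) * d))"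
      using sum_affine[of 1 "\<lambda>c. \<eta> c ^ 23 * \<eta> d ^ 7 * \<phi> (1 + c + d + l * c * d)" "- d"] by simp
  qed
  also have "\<dots> = (\<Sum>z\<in>UNIV. \<Sum>d\<in>UNIV. (\<eta> (d * (z - d)) ^ 23 * \<phi> (1 + z + l * (d * (z - d)))) * \<eta> d ^ 8)"
  proof (subst sum.swap, intro sum.cong refl)
    fix z d
    \<comment> \<open>Here 23 + 8 = 31, which is 7 modulo 24.\<close>
    have "\<eta> (d * (z - d)) ^ 23 * \<eta> d ^ 8 = \<eta> (z - d) ^ 23 * \<eta> d ^ 7"
      using eta_pow_add_24[of 7 d] by (simp add: eta_mult power_mult_distrib flip: power_add)
    moreover have "1 + (z - d) + d + l * (z - d) * d = 1 + z + l * (d * (z - d))"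
      by (simp add: algebra_simps)
    ultimately show "\<eta> (z - d) ^ 23 * \<eta> d ^ 7 * \<phi> (1 + (z - d) + d + l * (z - d) * d) =
      (\<eta> (d * (z - d)) ^ 23 * \<phi> (1 + z + l * (d * (z - d)))) * \<eta> d ^ 8"
      by (simp only: mult.assoc mult.commute[of "\<phi> _" "\<eta> d ^ 8"])
         (simp only: mult.assoc[symmetric])
  qed
  also have "\<dots> = (\<Sum>z\<in>UNIV. \<Sum>t\<in>UNIV. (\<eta> t ^ 23 * \<phi> (1 + z + l * t)) * (\<Sum>d | d * (z - d) = t. \<eta> d ^ 8))"
    by (intro sum.cong refl sum_level)
  \<comment> \<open>\<open>card_cubic_roots\<close> has summands \<open>\<eta> (t * d) ^ 8\<close>;
    splitting 23 = 15 + 8 supplies the missing \<open>\<eta> t ^ 8\<close>.\<close>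
  also have "\<dots> = (\<Sum>t\<in>UNIV. \<Sum>z\<in>UNIV. \<eta> t ^ 15 * (\<phi> (1 + z + l * t) * (?N t z - 1)))"
  proof (subst sum.swap, intro sum.cong refl)
    fix t z
    show "(\<eta> t ^ 23 * \<phi> (1 + z + l * t)) * (\<Sum>d | d * (z - d) = t. \<eta> d ^ 8) =
      \<eta> t ^ 15 * (\<phi> (1 + z + l * t) * (?N t z - 1))"
    proof (cases "t = 0")
      case False
      have "\<eta> t ^ 15 * (?N t z - 1) = \<eta> t ^ 15 * \<eta> t ^ 8 * (\<Sum>d | d * (z - d) = t. \<eta> d ^ 8)"
        unfolding card_cubic_roots[OF False, symmetric]
        by (simp add: eta_mult power_mult_distrib sum_distrib_left mult.assoc)
      also have "\<eta> t ^ 15 * \<eta> t ^ 8 = \<eta> t ^ 23" by (simp flip: power_add)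
      finally show ?thesis by (simp add: ac_simps)
    qed simp
  qed
  also have "\<dots> = (\<Sum>t\<in>UNIV. \<eta> t ^ 3 * (\<Sum>x\<in>UNIV. \<phi> (x ^ 3 - 3 * t * x + t + l * t ^ 2)))"
  proof (rule sum.cong[OF refl])
    fix t
    show "(\<Sum>z\<in>UNIV. \<eta> t ^ 15 * (\<phi> (1 + z + l * t) * (?N t z - 1))) =
      \<eta> t ^ 3 * (\<Sum>x\<in>UNIV. \<phi> (x ^ 3 - 3 * t * x + t + l * t ^ 2))"
    proof (cases "t = 0")
      case False
      have root: "x ^ 3 = t * (z + 3 * x) \<longleftrightarrow> x ^ 3 / t - 3 * x = z" for x z
        using False by (auto simp: field_simps)
      have "(\<Sum>z\<in>UNIV. \<phi> (1 + z + l * t)) = (\<Sum>z\<in>UNIV. \<phi> z)"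
        using sum_affine[of 1 "\<lambda>z. \<phi> z" "1 + l * t"] by (simp add: algebra_simps)
      then have 0: "(\<Sum>z\<in>UNIV. \<phi> (1 + z + l * t)) = 0"
        using eta_pow_sum[of 12] by simp
      \<comment> \<open>The \<open>- 1\<close> drops out, as it multiplies a complete sum of
        \<phi>.\<close>
      have "(\<Sum>z\<in>UNIV. \<phi> (1 + z + l * t) * (?N t z - 1)) = (\<Sum>z\<in>UNIV. \<phi> (1 + z + l * t) * ?N t z)"
        using 0 by (simp add: right_diff_distrib sum_subtractf)
      also have "\<dots> = (\<Sum>z\<in>UNIV. \<phi> (1 + z + l * t) * (\<Sum>x | x ^ 3 / t - 3 * x = z. 1))"
        by (simp add: root)
      also have "\<dots> = (\<Sum>x\<in>UNIV. \<phi> (1 + (x ^ 3 / t - 3 * x) + l * t) * 1)"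
        by (rule sum_level[symmetric])
      \<comment> \<open>Since \<open>\<eta> t ^ 15 = \<eta> t ^ 3 * \<phi> t\<close>, a factor
        \<open>t\<close> moves inside \<phi> and clears the denominator.\<close>
      finally have "(\<Sum>z\<in>UNIV. \<eta> t ^ 15 * (\<phi> (1 + z + l * t) * (?N t z - 1))) =
          (\<Sum>x\<in>UNIV. \<eta> t ^ 3 * \<phi> (t * (1 + (x ^ 3 / t - 3 * x) + l * t)))"
        by (simp add: phi_mult flip: sum_distrib_left)
      moreover have "t * (1 + (x ^ 3 / t - 3 * x) + l * t) = x ^ 3 - 3 * t * x + t + l * t ^ 2" for x
        using False by (simp add: field_simps power2_eq_square)
      ultimately show ?thesis by (simp add: sum_distrib_left)
    qed simp
  qed
  finally show ?thesis .
qed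

section \<open>Quartics and their Jacobian cubics\<close>

lemma eta_divide_pow: "\<eta> (x / y) ^ n = \<eta> x ^ n * inverse (\<eta> y ^ n)"
  by (simp only: eta_divide power_divide divide_inverse[of "\<eta> x ^ n"])

text \<open>The points of the curve \<open>K y w\<close>, quadratic in each variable, are counted
  along both projections: fibres over \<open>y\<close> give the quartic, fibres over
  \<open>w\<close> the cubic \<open>D\<close>, since \<open>16 * D w\<close> is the discriminant in
  \<open>y\<close>. The fibre at \<open>w = - 1 / 8\<close>, where the leading coefficient vanishes,
  causes the \<open>- 1\<close>.\<close>

lemma sum_phi_quartic:
  assumes "1 + 8 * x \<noteq> 0"
  shows "(\<Sum>y\<in>UNIV. \<phi> (- (y ^ 4) + y ^ 3 + T * x * (y - x)))
    = (\<Sum>w\<in>UNIV. \<phi> (- 8 * w ^ 3 + T * x * (8 * x - 2) * w + T ^ 2 * x ^ 2 + T * x ^ 2)) - 1"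
proof -
  define G where "G y = - (y ^ 4) + y ^ 3 + T * x * (y - x)" for y
  define D where "D w = - 8 * w ^ 3 + T * x * (8 * x - 2) * w + T ^ 2 * x ^ 2 + T * x ^ 2" for w
  define K where "K y w \<longleftrightarrow> (1 + 8 * w) * y ^ 2 + 4 * (T * x - w) * y + 4 * (w ^ 2 - T * x ^ 2) = 0" for y w
  obtain i :: 'a where i: "i ^ 2 = - 1" by (rule minus_1_square)
  then have i0: "i \<noteq> 0" by auto
  have sixteen: "(16::'a) \<noteq> 0" using four_neq_0 mult_eq_0_iff[of "4::'a" 4] by simp
  have phi16: "\<phi> 16 = 1" using phi_square[of 4] four_neq_0 by simp
  have fibre_y: "of_nat (card {w. K y w}) = 1 + \<phi> (G y)" for y
  proof -
    \<comment> \<open>The substitution \<open>v = i(y\<^sup>2 - y/2 + w)\<close> cancels the two leading terms of the quartic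
      and leaves an equation of degree 2 in \<open>y\<close>.\<close>
    define b where "b = y ^ 2 - y / 2"
    have b: "2 * b = 2 * y ^ 2 - y" using two_neq_0 by (simp add: b_def field_simps)
    have iff: "K y w \<longleftrightarrow> (i * (b + w)) ^ 2 = G y" for w
    proof -
      have "4 * ((i * (b + w)) ^ 2 - G y) = i ^ 2 * (2 * b + 2 * w) ^ 2 - 4 * G y"
        by algebra
      also have "\<dots> = - ((1 + 8 * w) * y ^ 2 + 4 * (T * x - w) * y + 4 * (w ^ 2 - T * x ^ 2))"
        unfolding i b G_def by algebra
      finally show ?thesis unfolding K_def using four_neq_0
        by (metis eq_iff_diff_eq_0 mult_eq_0_iff neg_equal_0_iff_equal)
    qed
    have "bij_betw (\<lambda>w. i * (b + w)) {w. (i * (b + w)) ^ 2 = G y} {v. v ^ 2 = G y}"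
      by (rule bij_betw_byWitness[where f' = "\<lambda>v. v / i - b"]) (use i0 in auto)
    then show ?thesis using card_sqrt[of "G y"] by (simp add: iff bij_betw_same_card)
  qed
  have fibre_w: "of_nat (card {y. K y w}) = \<phi> (D w) + (if w = - 1 / 8 then 0 else 1)" for w
  proof (cases "w = - 1 / 8")
    case True
    then have w: "8 * w = - 1" using eight_neq_0 by simp
    \<comment> \<open>The equation is now linear in \<open>y\<close> with slope
      \<open>8 * u\<close>, and \<open>64 * D w = u ^ 2\<close>: one point if \<open>u\<close> is
      nonzero. If \<open>u = 0\<close>, the constant \<open>64 * T * x ^ 2 - 1\<close> equals
      \<open>- (1 + 8 * x)\<close>, so the fibre is empty by assumption.\<close>
    define u where "u = 8 * T * x + 1"
    have K: "K y w \<longleftrightarrow> 8 * u * y = 64 * T * x ^ 2 - 1" for y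
    proof -
      have "16 * ((1 + 8 * w) * y ^ 2 + 4 * (T * x - w) * y + 4 * (w ^ 2 - T * x ^ 2))
        = 16 * (1 + 8 * w) * y ^ 2 + 8 * (8 * T * x - 8 * w) * y + ((8 * w) ^ 2 - 64 * T * x ^ 2)"
        by algebra
      also have "\<dots> = 8 * u * y - (64 * T * x ^ 2 - 1)"
        unfolding w u_def by algebra
      finally show ?thesis unfolding K_def
        using sixteen by (metis eq_iff_diff_eq_0 mult_eq_0_iff)
    qed
    have "64 * D w = - ((8 * w) ^ 3) + 8 * (8 * w) * T * x * (8 * x - 2) + 64 * T ^ 2 * x ^ 2 + 64 * T * x ^ 2"
      unfolding D_def by algebra
    also have "\<dots> = u ^ 2" unfolding w u_def by algebra
    finally have D: "8 ^ 2 * D w = u ^ 2" by simp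
    show ?thesis
    proof (cases "u = 0")
      case u: True
      then have "8 * T * x = - 1" by (simp add: u_def eq_neg_iff_add_eq_0)
      then have "64 * T * x ^ 2 - 1 = - (1 + 8 * x)" by algebra
      then have "64 * T * x ^ 2 - 1 \<noteq> 0" using assms by (metis neg_equal_0_iff_equal)
      then have "\<not> K y w" for y unfolding K u by (metis mult_zero_left mult_zero_right)
      moreover have "D w = 0" using D u eight_neq_0 by (metis mult_eq_0_iff power2_eq_square)
      ultimately show ?thesis using True by simp
    next
      case False
      have "K y w \<longleftrightarrow> y = (64 * T * x ^ 2 - 1) / (8 * u)" for y
        unfolding K using False eight_neq_0 by (auto simp: field_simps)
      moreover have "\<phi> (8 ^ 2) * \<phi> (D w) = 1"
        using D phi_square[OF False] by (metis phi_mult)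
      ultimately show ?thesis using True phi_square[OF eight_neq_0] by simp
    qed
  next
    case False
    then have "1 + 8 * w \<noteq> 0" using eight_neq_0 by (auto simp: field_simps add_eq_0_iff)
    then have "of_nat (card {y. K y w})
        = 1 + \<phi> ((4 * (T * x - w)) ^ 2 - 4 * (1 + 8 * w) * (4 * (w ^ 2 - T * x ^ 2)))"
      unfolding K_def by (rule card_quadratic)
    also have "(4 * (T * x - w)) ^ 2 - 4 * (1 + 8 * w) * (4 * (w ^ 2 - T * x ^ 2)) = 16 * D w"
      unfolding D_def by algebra
    finally show ?thesis using False by (simp only: phi_mult phi16) simp
  qed
  let ?q = "of_nat (card (UNIV::'a set)) :: complex"
  have "?q + (\<Sum>y\<in>UNIV. \<phi> (G y)) = (\<Sum>y\<in>UNIV. of_nat (card {w. K y w}))"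
    by (simp add: fibre_y sum.distrib)
  also have "\<dots> = (\<Sum>w\<in>UNIV. of_nat (card {y. K y w}))"
    by (rule sum_card_swap)
  also have "\<dots> = (\<Sum>w\<in>UNIV. \<phi> (D w)) + (\<Sum>w\<in>(UNIV :: 'a set). 1 - (if w = - 1 / 8 then 1 else 0))"
    unfolding sum.distrib[symmetric] by (intro sum.cong refl) (simp add: fibre_w)
  also have "(\<Sum>w\<in>(UNIV :: 'a set). 1 - (if w = - 1 / 8 then 1 else 0) :: complex) = ?q - 1"
    by (simp add: sum_subtractf)
  finally show ?thesis by (simp add: G_def D_def)
qed

section \<open>Evaluation of the quartic sum by pairing\<close>

text \<open>For a root \<open>v\<close> and \<open>s ^ 2 = p\<close> one has
  \<open>v * (e + 2 * s) = (v + s) ^ 2\<close>, so both factors have the same quadratic character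
  unless \<open>v = - s\<close>. If \<open>p\<close> is not a square, the values at two roots of
  product \<open>p\<close> cancel. If the quadratic has no root, \<open>\<phi> (e + 2 * s)\<close>
  and \<open>\<phi> (e - 2 * s)\<close> cancel, as the product of their arguments is the
  discriminant.\<close>

lemma sum_phi_quadratic_roots:
  "(\<Sum>v | v ^ 2 - e * v + p = 0. \<phi> v) = (\<Sum>s | s ^ 2 = p. \<phi> (e + 2 * s))"
proof -
  have two_roots: "{v. v ^ 2 - e * v + p = 0} = {v, e - v}" and prod: "v * (e - v) = p"
    if v: "v ^ 2 - e * v + p = 0" for v
  proof -
    show p: "v * (e - v) = p" using v by algebra
    have "x ^ 2 - e * x + p = (x - v) * (x - (e - v))" for x
      unfolding p[symmetric] by algebra
    then show "{v. v ^ 2 - e * v + p = 0} = {v, e - v}" by auto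
  qed
  have phi_eq: "\<phi> a = \<phi> b" if "a * b = c ^ 2" "c \<noteq> 0" for a b c
  proof -
    have "\<phi> a * \<phi> b = 1" using phi_square[OF that(2)] that(1) by (metis phi_mult)
    moreover have "a \<noteq> 0" "b \<noteq> 0" using that by auto
    ultimately show ?thesis using phi_cases[of a] phi_cases[of b] by auto
  qed
  have phi_neg: "\<phi> a + \<phi> b = 0" if "\<nexists>c. c ^ 2 = a * b" for a b
  proof -
    have "a * b \<noteq> 0" using that by (metis zero_power2)
    then have "\<phi> (a * b) \<noteq> 1" "a \<noteq> 0" "b \<noteq> 0" using that phi_eq_1_iff by auto
    then show ?thesis using phi_cases[of a] phi_cases[of b] by (auto simp: phi_mult)
  qed
  show ?thesis
  proof (cases "\<exists>s. s ^ 2 = p")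
    case False
    have "(\<Sum>v | v ^ 2 - e * v + p = 0. \<phi> v) = 0"
    proof (cases "\<exists>v. v ^ 2 - e * v + p = 0")
      case True
      then obtain v where v: "v ^ 2 - e * v + p = 0" by blast
      have "v \<noteq> e - v" using prod[OF v] False by (metis power2_eq_square)
      then show ?thesis
        using phi_neg[of v "e - v"] False unfolding two_roots[OF v] prod[OF v] by simp
    qed simp
    then show ?thesis using False by simp
  next
    case True
    then obtain s where s: "s ^ 2 = p" by blast
    have "x ^ 2 = p \<longleftrightarrow> x = s \<or> x = - s" for x
      unfolding s[symmetric] by (rule power2_eq_iff)
    then have roots: "{s. s ^ 2 = p} = {s, - s}" by auto
    show ?thesis
    proof (cases "s = 0")
      case True
      then have "{v. v ^ 2 - e * v + p = 0} = {0, e}"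
        using s by (auto simp: power2_eq_square)
      then show ?thesis using True unfolding roots by (cases "e = 0") auto
    next
      case s0: False
      have ss: "s \<noteq> - s"
        using s0 two_neq_0 by (metis add_eq_0_iff mult_2 mult_eq_0_iff)
      have rhs: "(\<Sum>s | s ^ 2 = p. \<phi> (e + 2 * s)) = \<phi> (e + 2 * s) + \<phi> (e - 2 * s)"
        using ss unfolding roots by simp
      show ?thesis
      proof (cases "\<exists>v. v ^ 2 - e * v + p = 0")
        case True
        then obtain v where v: "v ^ 2 - e * v + p = 0" by blast
        have sq: "v * (e + 2 * c) = (v + c) ^ 2" if "c ^ 2 = p" for c
          using v that by algebra
        have pls: "\<phi> (e + 2 * s) = \<phi> v" if "v \<noteq> - s"
          using phi_eq[OF sq[OF s]] that by (simp add: eq_neg_iff_add_eq_0)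
        have mns: "\<phi> (e - 2 * s) = \<phi> v" if "v \<noteq> s"
          using phi_eq[OF sq[of "- s"]] s that by simp
        \<comment> \<open>The square \<open>(v + c) ^ 2\<close> degenerates only at a double
          root.\<close>
        have vs: "v = e - v" if "v = s \<or> v = - s"
        proof -
          have "v * (e - v) = v * v" using that s prod[OF v] by (auto simp: power2_eq_square)
          moreover have "v \<noteq> 0" using that s0 by auto
          ultimately show ?thesis by simp
        qed
        have lhs: "(\<Sum>v | v ^ 2 - e * v + p = 0. \<phi> v) = (if v = e - v then \<phi> v else 2 * \<phi> v)"
        proof (cases "v = e - v")
          case False
          have "v * (e - v) = s ^ 2" using prod[OF v] s by simp
          then show ?thesis using False phi_eq s0 unfolding two_roots[OF v] by fastforce
        next
          case True
          then have "{v, e - v} = {v}" by auto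
          then show ?thesis using True by (simp only: two_roots[OF v]) simp
        qed
        show ?thesis
        proof (cases "v = e - v")
          case eq: True
          then have "v ^ 2 = s ^ 2" using prod[OF v] s by (metis power2_eq_square)
          then have "v = s \<or> v = - s" by (simp add: power2_eq_iff)
          moreover have "e = 2 * v" using eq by (metis add.commute diff_add_cancel mult_2)
          ultimately show ?thesis
            using lhs rhs eq pls mns ss by auto
        next
          case False
          then have "v \<noteq> s" "v \<noteq> - s" using vs by auto
          then show ?thesis using False lhs rhs pls mns by (simp only: if_False) simp
        qed
      next
        case False
        have "\<nexists>c. c ^ 2 = (e + 2 * s) * (e - 2 * s)"
        proof
          assume "\<exists>c. c ^ 2 = (e + 2 * s) * (e - 2 * s)"
          then obtain c where "c ^ 2 = (e + 2 * s) * (e - 2 * s)" by blast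
          then have c: "c ^ 2 = e ^ 2 - 4 * p" using s by algebra
          define v where "v = (e + c) / 2"
          have "2 * v = e + c" using two_neq_0 by (simp add: v_def)
          then have "4 * (v ^ 2 - e * v + p) = 0" using c by algebra
          then show False using False four_neq_0 by (metis mult_eq_0_iff)
        qed
        then show ?thesis using False rhs phi_neg by auto
      qed
    qed
  qed
qed

text \<open>For \<open>S = y * (y - x) / (1 - y)\<close>, the element \<open>v = 1 - y\<close>
  solves \<open>v ^ 2 - (2 - x + S) * v + (1 - x) = 0\<close>. Trading these roots for the square
  roots \<open>s\<close> of \<open>1 - x\<close> gives \<open>\<phi> ((1 + s) ^ 2 + S)\<close>,
  linear in \<open>S\<close>, hence a Jacobi sum. The exponent 18 is 2 * 21 modulo 24.\<close>

lemma dihedral_sum: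
  assumes x: "x \<noteq> 0"
  shows "(\<Sum>y\<in>UNIV. \<eta> (y * (y - x)) ^ 21 * \<eta> (1 - y) ^ 15)
    = \<eta> (- 1) ^ 21 * J 21 * (\<Sum>s | s ^ 2 = 1 - x. \<eta> (1 + s) ^ 18)"
proof -
  have "(\<Sum>y\<in>UNIV. \<eta> (y * (y - x)) ^ 21 * \<eta> (1 - y) ^ 15)
      = (\<Sum>y\<in>UNIV. \<eta> (y * (y - x) / (1 - y)) ^ 21 * \<phi> (1 - y))"
  proof (rule sum.cong[OF refl])
    fix y
    have "inverse (\<eta> (1 - y) ^ 21) * \<phi> (1 - y) = \<eta> (1 - y) ^ 15"
      by (simp add: inverse_eta_pow flip: power_add)
    then show "\<eta> (y * (y - x)) ^ 21 * \<eta> (1 - y) ^ 15 = \<eta> (y * (y - x) / (1 - y)) ^ 21 * \<phi> (1 - y)"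
      by (simp only: eta_divide_pow mult.assoc)
  qed
  also have "\<dots> = (\<Sum>S\<in>UNIV. \<eta> S ^ 21 * (\<Sum>y | y * (y - x) / (1 - y) = S. \<phi> (1 - y)))"
    by (rule sum_level)
  also have "\<dots> = (\<Sum>S\<in>UNIV. \<eta> S ^ 21 * (\<Sum>s | s ^ 2 = 1 - x. \<phi> ((1 + s) ^ 2 + S * 1)))"
  proof (rule sum.cong[OF refl])
    fix S
    show "\<eta> S ^ 21 * (\<Sum>y | y * (y - x) / (1 - y) = S. \<phi> (1 - y))
        = \<eta> S ^ 21 * (\<Sum>s | s ^ 2 = 1 - x. \<phi> ((1 + s) ^ 2 + S * 1))"
    \<comment> \<open>By the default value of division, \<open>y = 1\<close> lies in the fibre over
      0; that fibre has weight \<open>\<eta> 0 ^ 21 = 0\<close>.\<close>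
    proof (cases "S = 0")
      case False
      have iff: "y * (y - x) / (1 - y) = S \<longleftrightarrow>
          (1 - y) ^ 2 - (2 - x + S) * (1 - y) + (1 - x) = 0 \<and> y \<noteq> 1" for y
      proof -
        have "(1 - y) ^ 2 - (2 - x + S) * (1 - y) + (1 - x) = y * (y - x) - S * (1 - y)"
          by algebra
        then show ?thesis using False by (cases "y = 1") (auto simp: divide_eq_eq)
      qed
      \<comment> \<open>The quadratic may admit \<open>y = 1\<close>, where
        \<open>\<phi> (1 - y)\<close> is 0.\<close>
      have "(\<Sum>y | y * (y - x) / (1 - y) = S. \<phi> (1 - y))
          = (\<Sum>y | (1 - y) ^ 2 - (2 - x + S) * (1 - y) + (1 - x) = 0. \<phi> (1 - y))"
        by (rule sum.mono_neutral_left) (auto simp: iff)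
      also have "\<dots> = (\<Sum>v | v ^ 2 - (2 - x + S) * v + (1 - x) = 0. \<phi> v)"
        by (rule sum.reindex_bij_witness[where i = "\<lambda>v. 1 - v" and j = "\<lambda>y. 1 - y"]) auto
      also have "\<dots> = (\<Sum>s | s ^ 2 = 1 - x. \<phi> (2 - x + S + 2 * s))"
        by (rule sum_phi_quadratic_roots)
      also have "\<dots> = (\<Sum>s | s ^ 2 = 1 - x. \<phi> ((1 + s) ^ 2 + S * 1))"
      proof (rule sum.cong[OF refl])
        fix s assume "s \<in> {s. s ^ 2 = 1 - x}"
        then have "2 - x + S + 2 * s = (1 + s) ^ 2 + S * 1" by algebra
        then show "\<phi> (2 - x + S + 2 * s) = \<phi> ((1 + s) ^ 2 + S * 1)" by (simp only:)
      qed
      finally show ?thesis by simp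
    qed simp
  qed
  also have "\<dots> = (\<Sum>s | s ^ 2 = 1 - x. \<Sum>S\<in>UNIV. \<eta> S ^ 21 * \<phi> ((1 + s) ^ 2 + S * 1))"
    unfolding sum_distrib_left by (rule sum.swap)
  also have "\<dots> = (\<Sum>s | s ^ 2 = 1 - x. \<eta> (- 1) ^ 21 * J 21 * \<eta> (1 + s) ^ 18)"
  proof (rule sum.cong[OF refl])
    fix s assume "s \<in> {s. s ^ 2 = 1 - x}"
    then have s: "1 + s \<noteq> 0" using x by (auto simp: add_eq_0_iff)
    have "\<eta> (- ((1 + s) ^ 2) / 1) ^ 21 = \<eta> (- 1) ^ 21 * \<eta> (1 + s) ^ 18"
      using eta_mult[of "- 1" "(1 + s) ^ 2"] eta_pow_add_24[of 18 "1 + s"]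
      by (simp add: eta_power power_mult_distrib flip: power_mult)
    moreover have "\<phi> ((1 + s) ^ 2) = 1" by (rule phi_square[OF s])
    ultimately show "(\<Sum>S\<in>UNIV. \<eta> S ^ 21 * \<phi> ((1 + s) ^ 2 + S * 1)) = \<eta> (- 1) ^ 21 * J 21 * \<eta> (1 + s) ^ 18"
      by (subst sum_linear_phi) (simp_all add: ac_simps)
  qed
  finally show ?thesis by (simp add: sum_distrib_left)
qed

text \<open>The quartic is \<open>y ^ 3 * (1 - y) + T * (x * (y - x))\<close>. Its sum over
  \<open>T\<close> is a Jacobi sum whose character factors, reduced modulo 24, form the summand of
  \<open>dihedral_sum\<close>.\<close>

lemma quartic_sum:
  assumes x: "x \<noteq> 0"
  shows "(\<Sum>T\<in>UNIV. \<eta> T ^ 3 * (\<Sum>y\<in>UNIV. \<phi> (- (y ^ 4) + y ^ 3 + T * x * (y - x))))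
    = J 3 * J 21 * \<eta> x ^ 21 * (\<Sum>s | s ^ 2 = 1 - x. \<eta> (1 + s) ^ 18)"
proof -
  have "(\<Sum>T\<in>UNIV. \<eta> T ^ 3 * (\<Sum>y\<in>UNIV. \<phi> (- (y ^ 4) + y ^ 3 + T * x * (y - x))))
      = (\<Sum>y\<in>UNIV. \<Sum>T\<in>UNIV. \<eta> T ^ 3 * \<phi> (y ^ 3 * (1 - y) + T * (x * (y - x))))"
    unfolding sum_distrib_left
    by (subst sum.swap) (simp add: algebra_simps power4_eq_xxxx power3_eq_cube)
  also have "\<dots> = (\<Sum>y\<in>UNIV. J 3 * \<eta> (- 1) ^ 3 * \<eta> x ^ 21 * (\<eta> (y * (y - x)) ^ 21 * \<eta> (1 - y) ^ 15))"
  proof (rule sum.cong[OF refl])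
    fix y
    have eq: "- (y ^ 3 * (1 - y)) / (x * (y - x)) = (- 1) * y ^ 3 * (1 - y) / (x * (y - x))" by simp
    have "\<eta> (- (y ^ 3 * (1 - y)) / (x * (y - x))) ^ 3
        = \<eta> (- 1) ^ 3 * \<eta> y ^ 9 * \<eta> (1 - y) ^ 3 * (inverse (\<eta> x ^ 3) * inverse (\<eta> (y - x) ^ 3))"
      unfolding eq eta_divide_pow
      by (simp only: eta_mult eta_power zero_less_numeral power_mult_distrib inverse_mult_distrib
          power_mult[symmetric]) simp
    moreover have "\<phi> (y ^ 3 * (1 - y)) = \<eta> y ^ 36 * \<phi> (1 - y)"
      by (simp add: eta_mult eta_power power_mult_distrib flip: power_mult)
    ultimately have "\<eta> (- (y ^ 3 * (1 - y)) / (x * (y - x))) ^ 3 * \<phi> (y ^ 3 * (1 - y))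
        = \<eta> (- 1) ^ 3 * inverse (\<eta> x ^ 3) * ((\<eta> y ^ 9 * \<eta> y ^ 36) * inverse (\<eta> (y - x) ^ 3)
            * (\<eta> (1 - y) ^ 3 * \<phi> (1 - y)))"
      by (simp only: ac_simps)
    also have "\<eta> y ^ 9 * \<eta> y ^ 36 = \<eta> y ^ 21"
      using eta_pow_add_24[of 21 y] by (simp flip: power_add)
    also have "\<eta> (1 - y) ^ 3 * \<phi> (1 - y) = \<eta> (1 - y) ^ 15"
      by (simp flip: power_add)
    also have "\<eta> y ^ 21 * inverse (\<eta> (y - x) ^ 3) = \<eta> (y * (y - x)) ^ 21"
      by (simp add: inverse_eta_pow eta_mult power_mult_distrib)
    also have "inverse (\<eta> x ^ 3) = \<eta> x ^ 21"
      by (simp add: inverse_eta_pow)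
    finally have "\<eta> (- (y ^ 3 * (1 - y)) / (x * (y - x))) ^ 3 * \<phi> (y ^ 3 * (1 - y))
        = \<eta> (- 1) ^ 3 * \<eta> x ^ 21 * (\<eta> (y * (y - x)) ^ 21 * \<eta> (1 - y) ^ 15)" .
    then show "(\<Sum>T\<in>UNIV. \<eta> T ^ 3 * \<phi> (y ^ 3 * (1 - y) + T * (x * (y - x))))
        = J 3 * \<eta> (- 1) ^ 3 * \<eta> x ^ 21 * (\<eta> (y * (y - x)) ^ 21 * \<eta> (1 - y) ^ 15)"
      by (subst sum_linear_phi) (simp_all only: ac_simps, simp_all)
  qed
  also have "\<dots> = J 3 * \<eta> (- 1) ^ 3 * \<eta> x ^ 21
      * (\<eta> (- 1) ^ 21 * J 21 * (\<Sum>s | s ^ 2 = 1 - x. \<eta> (1 + s) ^ 18))"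
    unfolding sum_distrib_left[symmetric] dihedral_sum[OF x] ..
  also have "\<dots> = (\<eta> (- 1) ^ 3 * \<eta> (- 1) ^ 21) * (J 3 * J 21 * \<eta> x ^ 21 * (\<Sum>s | s ^ 2 = 1 - x. \<eta> (1 + s) ^ 18))"
    by (simp only: ac_simps)
  also have "\<eta> (- 1) ^ 3 * \<eta> (- 1) ^ 21 = 1"
    using eta_pow_24[of "- 1"] by (simp flip: power_add)
  finally show ?thesis by simp
qed

section \<open>Jacobi sums and the constant at \<open>l = 0\<close>\<close>

text \<open>The duplication formula: \<open>u = x * (1 - x)\<close> has
  \<open>1 + \<phi> (1 - 4 * u)\<close> solutions \<open>x\<close>, and the 1 contributes a
  vanishing character sum.\<close>

lemma jacobi_self: "jacobi (\<lambda>x. \<eta> x ^ 21) (\<lambda>x. \<eta> x ^ 21) = \<eta> 4 ^ 3 * J 21"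
proof -
  have "jacobi (\<lambda>x. \<eta> x ^ 21) (\<lambda>x. \<eta> x ^ 21) = (\<Sum>x\<in>UNIV. \<eta> (x * (1 - x)) ^ 21 * 1)"
    by (simp add: jacobi_def eta_mult power_mult_distrib)
  also have "\<dots> = (\<Sum>u\<in>UNIV. \<eta> u ^ 21 * (\<Sum>x | x * (1 - x) = u. 1))"
    by (rule sum_level)
  also have "\<dots> = (\<Sum>u\<in>UNIV. \<eta> u ^ 21 * (1 + \<phi> (1 + u * - 4)))"
  proof (rule sum.cong[OF refl])
    fix u :: 'a
    have "1 * x ^ 2 + (- 1) * x + u = u - x * (1 - x)" for x
      by algebra
    then have "x * (1 - x) = u \<longleftrightarrow> 1 * x ^ 2 + (- 1) * x + u = 0" for x
      by (metis eq_iff_diff_eq_0)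
    then show "\<eta> u ^ 21 * (\<Sum>x | x * (1 - x) = u. 1) = \<eta> u ^ 21 * (1 + \<phi> (1 + u * - 4))"
      using card_quadratic[of 1 "- 1" u] by (simp add: mult.commute)
  qed
  also have "\<dots> = (\<Sum>u\<in>UNIV. \<eta> u ^ 21) + (\<Sum>u\<in>UNIV. \<eta> u ^ 21 * \<phi> (1 + u * - 4))"
    by (simp only: distrib_left mult_1_right sum.distrib)
  also have "\<dots> = \<eta> (- 1 / - 4) ^ 21 * \<phi> 1 * J 21"
    using eta_pow_sum[of 21] by (subst sum_linear_phi) simp_all
  also have "\<eta> (- 1 / - 4) ^ 21 = \<eta> 4 ^ 3"
    using inverse_eta_pow[of 21 4] by (simp add: eta_divide_pow)
  finally show ?thesis by simp
qed

text \<open>The two factors are complex conjugates, so this is the absolute value of a Jacobi sum.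
  After \<open>x = y * u\<close>, the inner sum \<open>I u\<close> is \<open>- 1 - \<phi> u\<close>
  apart from an extra \<open>q\<close>, the field size, at \<open>u = 1\<close>; the rest cancels
  over \<open>u\<close>.\<close>

lemma jacobi_norm: "J 3 * J 21 = of_nat (card (UNIV :: 'a set))"
proof -
  let ?q = "of_nat (card (UNIV :: 'a set)) :: complex"
  define I where "I u = (\<Sum>y | y \<noteq> 0. \<phi> (1 - y * u) * \<phi> (1 - y))" for u
  have "J 3 * J 21 = (\<Sum>y\<in>UNIV. \<Sum>x\<in>UNIV. (\<eta> x ^ 3 * \<phi> (1 - x)) * (\<eta> y ^ 21 * \<phi> (1 - y)))"
    unfolding jacobi_def sum_product by (rule sum.swap)
  also have "\<dots> = (\<Sum>y | y \<noteq> 0. \<Sum>x\<in>UNIV. (\<eta> x ^ 3 * \<phi> (1 - x)) * (\<eta> y ^ 21 * \<phi> (1 - y)))"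
    by (rule sum.mono_neutral_right) auto
  also have "\<dots> = (\<Sum>y | y \<noteq> 0. \<Sum>u\<in>UNIV. \<eta> u ^ 3 * (\<phi> (1 - y * u) * \<phi> (1 - y)))"
  proof (rule sum.cong[OF refl])
    fix y :: 'a assume "y \<in> {y. y \<noteq> 0}"
    then have y: "y \<noteq> 0" by simp
    have "(\<Sum>x\<in>UNIV. (\<eta> x ^ 3 * \<phi> (1 - x)) * (\<eta> y ^ 21 * \<phi> (1 - y)))
        = (\<Sum>u\<in>UNIV. (\<eta> (y * u + 0) ^ 3 * \<phi> (1 - (y * u + 0))) * (\<eta> y ^ 21 * \<phi> (1 - y)))"
      by (rule sum_affine[OF y, symmetric])
    also have "\<dots> = (\<Sum>u\<in>UNIV. \<eta> u ^ 3 * (\<phi> (1 - y * u) * \<phi> (1 - y)))"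
    proof (rule sum.cong[OF refl])
      fix u
      have "\<eta> (y * u) ^ 3 * \<eta> y ^ 21 = \<eta> u ^ 3 * \<eta> y ^ 24"
        by (simp add: eta_mult power_mult_distrib ac_simps flip: power_add)
      also have "\<dots> = \<eta> u ^ 3" using eta_pow_24[OF y] by simp
      finally show "(\<eta> (y * u + 0) ^ 3 * \<phi> (1 - (y * u + 0))) * (\<eta> y ^ 21 * \<phi> (1 - y))
          = \<eta> u ^ 3 * (\<phi> (1 - y * u) * \<phi> (1 - y))"
        by (simp add: ac_simps)
    qed
    finally show "(\<Sum>x\<in>UNIV. (\<eta> x ^ 3 * \<phi> (1 - x)) * (\<eta> y ^ 21 * \<phi> (1 - y)))
        = (\<Sum>u\<in>UNIV. \<eta> u ^ 3 * (\<phi> (1 - y * u) * \<phi> (1 - y)))" .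
  qed
  also have "\<dots> = (\<Sum>u\<in>UNIV. \<eta> u ^ 3 * I u)"
    unfolding I_def sum_distrib_left by (rule sum.swap)
  also have "\<dots> = (\<Sum>u\<in>UNIV. (if u = 1 then ?q else 0) - \<eta> u ^ 3 - \<eta> u ^ 15)"
  proof (rule sum.cong[OF refl])
    fix u
    show "\<eta> u ^ 3 * I u = (if u = 1 then ?q else 0) - \<eta> u ^ 3 - \<eta> u ^ 15"
    proof (cases "u = 1")
      case True
      have "I u = (\<Sum>y | (y::'a) \<noteq> 0. if y = 1 then 0 else 1)"
        unfolding I_def
      proof (rule sum.cong[OF refl])
        fix y
        show "\<phi> (1 - y * u) * \<phi> (1 - y) = (if y = 1 then 0 else 1)"
          using True eta_pow_24[of "1 - y"] by (auto simp flip: power_add)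
      qed
      also have "\<dots> = (\<Sum>y\<in>(UNIV :: 'a set). 1 - (if y = 0 then 1 else 0) - (if y = 1 then 1 else 0))"
        by (rule sum.mono_neutral_cong_left) auto
      also have "\<dots> = ?q - 2" by (simp add: sum_subtractf)
      finally show ?thesis using True by simp
    next
      case u: False
      have "I u = (\<Sum>y | y \<noteq> 0 \<and> y \<noteq> 1. \<phi> ((1 - y * u) / (1 - y)))"
        unfolding I_def
      proof (rule sum.mono_neutral_cong_right)
        fix y :: 'a assume "y \<in> {y. y \<noteq> 0 \<and> y \<noteq> 1}"
        show "\<phi> (1 - y * u) * \<phi> (1 - y) = \<phi> ((1 - y * u) / (1 - y))"
          by (simp add: eta_divide_pow inverse_eta_pow)
      qed auto
      \<comment> \<open>This Moebius map sends 0 to 1, 1 to infinity and infinity to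
        \<open>u\<close>, hence the excluded values.\<close>
      also have "\<dots> = (\<Sum>r | r \<noteq> 1 \<and> r \<noteq> u. \<phi> r)"
      proof (rule sum.reindex_bij_witness[where i = "\<lambda>r. (r - 1) / (r - u)" and j = "\<lambda>y. (1 - y * u) / (1 - y)"])
        fix y :: 'a assume "y \<in> {y. y \<noteq> 0 \<and> y \<noteq> 1}"
        then have y: "y \<noteq> 0" "1 - y \<noteq> 0" by auto
        have r: "(1 - y * u) / (1 - y) - 1 = y * (1 - u) / (1 - y)"
          "(1 - y * u) / (1 - y) - u = (1 - u) / (1 - y)"
          by (simp_all only: divide_diff_eq_iff[OF y(2)]) (simp_all add: algebra_simps)
        show "((1 - y * u) / (1 - y) - 1) / ((1 - y * u) / (1 - y) - u) = y"
          unfolding r using u y(2) by simp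
        have "(1 - y * u) / (1 - y) - 1 \<noteq> 0" "(1 - y * u) / (1 - y) - u \<noteq> 0"
          unfolding r using u y by simp_all
        then show "(1 - y * u) / (1 - y) \<in> {r. r \<noteq> 1 \<and> r \<noteq> u}" by auto
      next
        fix r assume "r \<in> {r. r \<noteq> 1 \<and> r \<noteq> u}"
        then have r: "r - 1 \<noteq> 0" "r - u \<noteq> 0" by auto
        have y: "1 - (r - 1) / (r - u) * u = r * (1 - u) / (r - u)"
          "1 - (r - 1) / (r - u) = (1 - u) / (r - u)"
          by (simp_all only: times_divide_eq_left diff_divide_eq_iff[OF r(2)]) (simp_all add: algebra_simps)
        show "(1 - (r - 1) / (r - u) * u) / (1 - (r - 1) / (r - u)) = r"
          unfolding y using u r(2) by simp
        have "1 - (r - 1) / (r - u) \<noteq> 0" unfolding y(2) using u r by simp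
        then show "(r - 1) / (r - u) \<in> {y. y \<noteq> 0 \<and> y \<noteq> 1}" using r by auto
      qed simp
      also have "\<dots> = (\<Sum>r\<in>UNIV. \<phi> r - (if r = 1 then 1 else 0) - (if r = u then \<phi> u else 0))"
        using u by (intro sum.mono_neutral_cong_left) auto
      also have "\<dots> = - 1 - \<phi> u"
        using eta_pow_sum[of 12] by (simp add: sum_subtractf)
      finally have I: "I u = - 1 - \<phi> u" .
      show ?thesis unfolding I using u by (simp add: right_diff_distrib flip: power_add)
    qed
  qed
  also have "\<dots> = ?q"
    using eta_pow_sum[of 3] eta_pow_sum[of 15] by (simp add: sum_subtractf)
  finally show ?thesis .
qed

lemma jacobi_norm_neq_0: "J 3 * J 21 \<noteq> 0"
  unfolding jacobi_norm by simp

text \<open>At \<open>l = 0\<close> the cubic is itself linear in \<open>t\<close>. The factors of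
  -12 come from the sign in the Jacobi sum, the scaling by 3 and the 4 in
  \<open>jacobi_self\<close>.\<close>

lemma Q_0: "Q 0 = \<eta> (- 12) ^ 3 * (J 3 * J 21)"
proof -
  have "Q 0 = (\<Sum>x\<in>UNIV. \<Sum>t\<in>UNIV. \<eta> t ^ 3 * \<phi> (x ^ 3 + t * (1 - 3 * x)))"
    unfolding Q_eq_cubic sum_distrib_left
    by (subst sum.swap) (simp add: algebra_simps)
  also have "\<dots> = (\<Sum>x\<in>UNIV. J 3 * \<eta> (- 1) ^ 3 * (\<eta> x ^ 21 * \<eta> (1 - 3 * x) ^ 21))"
  proof (rule sum.cong[OF refl])
    fix x :: 'a
    have eq: "- (x ^ 3) / (1 - 3 * x) = (- 1) * x ^ 3 / (1 - 3 * x)" by simp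
    have "\<eta> (- (x ^ 3) / (1 - 3 * x)) ^ 3 = \<eta> (- 1) ^ 3 * \<eta> x ^ 9 * inverse (\<eta> (1 - 3 * x) ^ 3)"
      unfolding eq eta_divide_pow
      by (simp only: eta_mult eta_power zero_less_numeral power_mult_distrib power_mult[symmetric]) simp
    moreover have "\<phi> (x ^ 3) = \<eta> x ^ 36"
      by (simp add: eta_power flip: power_mult)
    ultimately have "\<eta> (- (x ^ 3) / (1 - 3 * x)) ^ 3 * \<phi> (x ^ 3)
        = \<eta> (- 1) ^ 3 * ((\<eta> x ^ 9 * \<eta> x ^ 36) * inverse (\<eta> (1 - 3 * x) ^ 3))"
      by (simp only: ac_simps)
    also have "\<eta> x ^ 9 * \<eta> x ^ 36 = \<eta> x ^ 21"
      using eta_pow_add_24[of 21 x] by (simp flip: power_add)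
    also have "inverse (\<eta> (1 - 3 * x) ^ 3) = \<eta> (1 - 3 * x) ^ 21"
      by (simp add: inverse_eta_pow)
    finally show "(\<Sum>t\<in>UNIV. \<eta> t ^ 3 * \<phi> (x ^ 3 + t * (1 - 3 * x)))
        = J 3 * \<eta> (- 1) ^ 3 * (\<eta> x ^ 21 * \<eta> (1 - 3 * x) ^ 21)"
      by (subst sum_linear_phi) (simp_all only: ac_simps, simp_all)
  qed
  also have "\<dots> = J 3 * \<eta> (- 1) ^ 3 * (\<Sum>x\<in>UNIV. \<eta> x ^ 21 * \<eta> (1 - 3 * x) ^ 21)"
    by (simp only: sum_distrib_left)
  also have "(\<Sum>x\<in>UNIV. \<eta> x ^ 21 * \<eta> (1 - 3 * x) ^ 21)
      = (\<Sum>x\<in>UNIV. \<eta> 3 ^ 3 * (\<eta> (3 * x + 0) ^ 21 * \<eta> (1 - (3 * x + 0)) ^ 21))"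
  proof (rule sum.cong[OF refl])
    fix x
    have "\<eta> 3 ^ 3 * \<eta> (3 * x) ^ 21 = \<eta> 3 ^ 24 * \<eta> x ^ 21"
      by (simp add: eta_mult power_mult_distrib flip: power_add mult.assoc)
    also have "\<dots> = \<eta> x ^ 21" using eta_pow_24[OF three_neq_0] by simp
    finally show "\<eta> x ^ 21 * \<eta> (1 - 3 * x) ^ 21 = \<eta> 3 ^ 3 * (\<eta> (3 * x + 0) ^ 21 * \<eta> (1 - (3 * x + 0)) ^ 21)"
      by (simp add: mult.assoc[symmetric])
  qed
  also have "\<dots> = (\<Sum>x\<in>UNIV. \<eta> 3 ^ 3 * (\<eta> x ^ 21 * \<eta> (1 - x) ^ 21))"
    by (rule sum_affine[OF three_neq_0])
  also have "\<dots> = \<eta> 3 ^ 3 * (\<eta> 4 ^ 3 * J 21)"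
    using jacobi_self by (simp add: jacobi_def flip: sum_distrib_left)
  also have "J 3 * \<eta> (- 1) ^ 3 * (\<eta> 3 ^ 3 * (\<eta> 4 ^ 3 * J 21)) = \<eta> (- 1 * 3 * 4) ^ 3 * (J 3 * J 21)"
    by (simp only: eta_mult power_mult_distrib ac_simps)
  finally show ?thesis by simp
qed

section \<open>Evaluation at the given argument and normalization\<close>

lemma Q_eval:
  assumes x: "x \<noteq> 0" "1 + 8 * x \<noteq> 0" "1 - 4 * x \<noteq> 0"
  defines "l \<equiv> - 27 * x / (1 - 4 * x) ^ 3"
  shows "\<eta> l ^ 15 * Q l = J 3 * J 21 * \<eta> x ^ 21 * (\<Sum>s | s ^ 2 = 1 - x. \<eta> (1 + s) ^ 18)"
proof -
  define m where "m = 1 - 4 * x"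
  \<comment> \<open>Scaling \<open>w = \<delta> * z\<close> must turn \<open>D\<close> into
    \<open>l * x ^ 2\<close> times the cubic in \<open>Q_eq_cubic\<close>. The linear term
    determines \<delta>; the cubic term \<open>- 8 * \<delta> ^ 3 = l * x ^ 2\<close> then forces
    the stated value of \<open>l\<close>.\<close>
  define \<delta> where "\<delta> = 3 * x / (2 * m)"
  have m: "m \<noteq> 0" using x by (simp add: m_def)
  have "(27::'a) = 3 ^ 3" by simp
  then have "(27::'a) \<noteq> 0" using three_neq_0 by (metis power_not_zero)
  then have l0: "l \<noteq> 0" using x by (simp add: l_def)
  have \<delta>0: "\<delta> \<noteq> 0" using x m two_neq_0 three_neq_0 by (simp add: \<delta>_def)
  have "2 * m * \<delta> = 3 * x" using m two_neq_0 by (simp add: \<delta>_def)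
  then have d1: "x * (8 * x - 2) * \<delta> = - 3 * x ^ 2"
    unfolding m_def by algebra
  have "m ^ 3 * (- 8 * \<delta> ^ 3) = - ((2 * m * \<delta>) ^ 3)" by algebra
  also have "\<dots> = m ^ 3 * (l * x ^ 2)"
    unfolding \<open>2 * m * \<delta> = 3 * x\<close> using m
    by (simp add: l_def flip: m_def) (simp add: power3_eq_cube power2_eq_square)
  finally have d2: "- 8 * \<delta> ^ 3 = l * x ^ 2"
    using m by (metis mult_left_cancel power_not_zero)
  have cubic: "(\<Sum>y\<in>UNIV. \<phi> (- (y ^ 4) + y ^ 3 + (l * t) * x * (y - x))) + 1
      = \<phi> l * (\<Sum>z\<in>UNIV. \<phi> (z ^ 3 - 3 * t * z + t + l * t ^ 2))" for t
  proof -
    define D where "D w = - 8 * w ^ 3 + (l * t) * x * (8 * x - 2) * w + (l * t) ^ 2 * x ^ 2 + (l * t) * x ^ 2" for w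
    have "(\<Sum>y\<in>UNIV. \<phi> (- (y ^ 4) + y ^ 3 + (l * t) * x * (y - x))) + 1 = (\<Sum>w\<in>UNIV. \<phi> (D w))"
      using sum_phi_quartic[OF x(2), of "l * t"] by (simp add: D_def)
    also have "\<dots> = (\<Sum>z\<in>UNIV. \<phi> (D (\<delta> * z + 0)))"
      by (rule sum_affine[OF \<delta>0, symmetric])
    also have "\<dots> = (\<Sum>z\<in>UNIV. \<phi> l * \<phi> (z ^ 3 - 3 * t * z + t + l * t ^ 2))"
    proof (rule sum.cong[OF refl])
      fix z
      have "D (\<delta> * z + 0) = (- 8 * \<delta> ^ 3) * z ^ 3 + l * t * (x * (8 * x - 2) * \<delta>) * z + (l * t) ^ 2 * x ^ 2 + (l * t) * x ^ 2"
        unfolding D_def by algebra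
      also have "\<dots> = l * (x ^ 2 * (z ^ 3 - 3 * t * z + t + l * t ^ 2))"
        unfolding d1 d2 by algebra
      finally show "\<phi> (D (\<delta> * z + 0)) = \<phi> l * \<phi> (z ^ 3 - 3 * t * z + t + l * t ^ 2)"
        by (simp only: phi_mult phi_square[OF x(1)] mult_1)
    qed
    finally show ?thesis by (simp add: sum_distrib_left)
  qed
  define G where "G T = (\<Sum>y\<in>UNIV. \<phi> (- (y ^ 4) + y ^ 3 + T * x * (y - x)))" for T
  \<comment> \<open>In \<open>\<eta> l ^ 15 = \<eta> l ^ 3 * \<phi> l\<close>, the first factor
    changes \<open>t\<close> to \<open>T = l * t\<close> and the second absorbs the twist. The
    \<open>+ 1\<close> will vanish on summing over \<open>T\<close>.\<close>
  have "\<eta> l ^ 15 * Q l = (\<Sum>t\<in>UNIV. \<eta> (l * t) ^ 3 * (G (l * t) + 1))"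
    unfolding Q_eq_cubic sum_distrib_left[of "\<eta> l ^ 15"]
  proof (rule sum.cong[OF refl])
    fix t
    have "\<eta> l ^ 15 = \<eta> l ^ 3 * \<phi> l" by (simp flip: power_add)
    then show "\<eta> l ^ 15 * (\<eta> t ^ 3 * (\<Sum>x\<in>UNIV. \<phi> (x ^ 3 - 3 * t * x + t + l * t ^ 2)))
        = \<eta> (l * t) ^ 3 * (G (l * t) + 1)"
      unfolding G_def cubic by (simp only: eta_mult power_mult_distrib ac_simps)
  qed
  also have "\<dots> = (\<Sum>T\<in>UNIV. \<eta> T ^ 3 * (G T + 1))"
    using sum_affine[OF l0, of "\<lambda>T. \<eta> T ^ 3 * (G T + 1)" 0] by simp
  also have "\<dots> = (\<Sum>T\<in>UNIV. \<eta> T ^ 3 * G T)"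
    using eta_pow_sum[of 3] by (simp add: distrib_left sum.distrib)
  also have "\<dots> = J 3 * J 21 * \<eta> x ^ 21 * (\<Sum>s | s ^ 2 = 1 - x. \<eta> (1 + s) ^ 18)"
    unfolding G_def by (rule quartic_sum[OF x(1)])
  finally show ?thesis .
qed

lemma P_ratio:
  assumes x: "1 + 8 * x \<noteq> 0" "1 - 4 * x \<noteq> 0"
  shows "P (- 27 * x / (1 - 4 * x) ^ 3) / P 0
    = (\<Sum>s | s ^ 2 = 1 - x. \<eta> ((1 - s) ^ 2 / (4 * (1 - 4 * x))) ^ 3)"
proof -
  have Q0: "Q 0 \<noteq> 0"
  proof -
    have "(- 12::'a) = - 1 * (3 * 4)" by simp
    then have "(- 12::'a) \<noteq> 0"
      using three_neq_0 four_neq_0 by (metis mult_eq_0_iff neg_equal_0_iff_equal zero_neq_one)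
    then show ?thesis unfolding Q_0 using jacobi_norm_neq_0 by simp
  qed
  \<comment> \<open>Since \<open>Q 0 = J 23 * P 0\<close>, one nonzero value shows that neither
    factor vanishes.\<close>
  then have P0: "P 0 \<noteq> 0" and J23: "J 23 \<noteq> 0" unfolding Q_eq_P by auto
  show ?thesis
  proof (cases "x = 0")
    case True
    \<comment> \<open>At \<open>x = 0\<close> the left side is 1; on the right \<open>s = 1\<close>
      gives 0 and \<open>s = - 1\<close> gives 1.\<close>
    have "{s::'a. s ^ 2 = 1 - x} = {1, - 1}" using True by (auto simp: power2_eq_1_iff)
    moreover have "(1::'a) \<noteq> - 1" using two_neq_0 by (metis add_eq_0_iff one_add_one)
    moreover have "(1 + 1) ^ 2 / (4::'a) = 1" using four_neq_0 by simp
    ultimately show ?thesis using True P0 by simp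
  next
    case x0: False
    define l where "l = - 27 * x / (1 - 4 * x) ^ 3"
    define m where "m = 1 - 4 * x"
    have m: "m \<noteq> 0" using x by (simp add: m_def)
    let ?S = "\<Sum>s | s ^ 2 = 1 - x. \<eta> (1 + s) ^ 18"
    have *: "\<eta> l ^ 15 * \<eta> (- 12) ^ 3 * (Q l / Q 0) = \<eta> x ^ 21 * ?S"
    proof -
      have "\<eta> l ^ 15 * Q l = J 3 * J 21 * \<eta> x ^ 21 * ?S"
        unfolding l_def by (rule Q_eval[OF x0 x])
      moreover have "\<eta> (- 12) \<noteq> 0" using Q0 unfolding Q_0 by auto
      ultimately show ?thesis
        using jacobi_norm_neq_0 unfolding Q_0 by (simp add: field_simps)
    qed
    have "\<eta> l ^ 15 * \<eta> (- 12) ^ 3 = \<eta> x ^ 15 * \<eta> (4 * m) ^ 3"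
    proof -
      \<comment> \<open>From \<open>l = - 27 * x / m ^ 3\<close>; after applying the cube of
        \<open>\<eta>\<close>, the power of 3 has exponent 48 and disappears.\<close>
      have "l ^ 5 * - 12 * m ^ 15 = x ^ 5 * 4 * 3 ^ 16"
        using m by (simp add: l_def flip: m_def) (simp add: power_divide power_mult_distrib flip: power_mult)
      then have "\<eta> (l ^ 5 * - 12 * m ^ 15) ^ 3 = \<eta> (x ^ 5 * 4 * 3 ^ 16) ^ 3" by (simp only:)
      moreover have "\<eta> (l ^ 5 * - 12 * m ^ 15) ^ 3 = \<eta> l ^ 15 * \<eta> (- 12) ^ 3 * \<eta> m ^ 45"
        by (simp only: eta_mult eta_power zero_less_numeral power_mult_distrib power_mult[symmetric]) simp
      moreover have "\<eta> (x ^ 5 * 4 * 3 ^ 16) ^ 3 = \<eta> x ^ 15 * \<eta> 4 ^ 3 * \<eta> 3 ^ 48"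
        by (simp only: eta_mult eta_power zero_less_numeral power_mult_distrib power_mult[symmetric]) simp
      ultimately have "\<eta> l ^ 15 * \<eta> (- 12) ^ 3 * \<eta> m ^ 45 = \<eta> x ^ 15 * \<eta> 4 ^ 3 * \<eta> 3 ^ 48"
        by (simp only:)
      moreover have "\<eta> 3 ^ 48 = 1" using eta_pow_mod[OF three_neq_0, of 48] by simp
      moreover have "\<eta> m ^ 45 * \<eta> m ^ 3 = 1" using eta_pow_mod[OF m, of 48] by (simp flip: power_add)
      ultimately have "\<eta> l ^ 15 * \<eta> (- 12) ^ 3 * 1 = \<eta> x ^ 15 * \<eta> 4 ^ 3 * \<eta> m ^ 3"
        by (metis mult.assoc mult_1_right)
      then show ?thesis by (simp add: eta_mult power_mult_distrib mult.assoc)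
    qed
    then have "\<eta> x ^ 15 * (\<eta> (4 * m) ^ 3 * (Q l / Q 0)) = \<eta> x ^ 15 * (\<eta> x ^ 6 * ?S)"
      using * by (simp add: mult.assoc[symmetric] flip: power_add)
    then have "\<eta> (4 * m) ^ 3 * (Q l / Q 0) = \<eta> x ^ 6 * ?S"
      using x0 by (metis eta_eq_0_iff mult_left_cancel power_not_zero)
    also have "\<dots> = (\<Sum>s | s ^ 2 = 1 - x. \<eta> ((1 - s) ^ 2) ^ 3)"
      unfolding sum_distrib_left
    proof (rule sum.cong[OF refl])
      fix s assume "s \<in> {s. s ^ 2 = 1 - x}"
      then have xs: "x = (1 - s) * (1 + s)" by (simp add: power2_eq_square algebra_simps)
      then have "1 + s \<noteq> 0" using x0 by auto
      then have "\<eta> (1 + s) ^ 6 * \<eta> (1 + s) ^ 18 = 1" using eta_pow_24 by (simp flip: power_add)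
      then show "\<eta> x ^ 6 * \<eta> (1 + s) ^ 18 = \<eta> ((1 - s) ^ 2) ^ 3"
        unfolding xs by (simp add: eta_mult eta_power power_mult_distrib mult.assoc flip: power_mult)
    qed
    finally have "Q l / Q 0 = (\<Sum>s | s ^ 2 = 1 - x. \<eta> ((1 - s) ^ 2) ^ 3) / \<eta> (4 * m) ^ 3"
      using m four_neq_0 by (simp add: nonzero_eq_divide_eq mult.commute)
    also have "\<dots> = (\<Sum>s | s ^ 2 = 1 - x. \<eta> ((1 - s) ^ 2 / (4 * m)) ^ 3)"
      by (simp only: sum_divide_distrib eta_divide power_divide)
    finally show ?thesis
      using J23 unfolding Q_eq_P l_def m_def by simp
  qed
qed

text \<open>The normalizing Jacobi sum is \<open>P 0\<close>, because the third factor of the period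
  function is \<open>\<eta> 1 = 1\<close> there. Conjugation inverts values of absolute value 1,
  giving exponent 18 - 7.\<close>

lemma F21_eq: "F21 (char_conj \<eta>) (char_pow \<eta> 7) (char_pow \<eta> 18) l = P l / P 0"
proof -
  have cnj: "cnj (\<eta> y) ^ 7 * \<eta> y ^ 18 = \<eta> y ^ 11" for y
  proof (cases "y = 0")
    case False
    have "cmod (\<eta> y) ^ 24 = 1" using eta_pow_24[OF False] by (metis norm_one norm_power)
    then have "cmod (\<eta> y) = 1" using power_eq_imp_eq_base[of "cmod (\<eta> y)" 24 1] by simp
    then have "cnj (\<eta> y) * \<eta> y = 1" by (simp add: complex_norm_square[symmetric] mult.commute)
    then have "(cnj (\<eta> y) * \<eta> y) ^ 7 * \<eta> y ^ 11 = \<eta> y ^ 11" by simp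
    then show ?thesis by (simp add: power_mult_distrib mult.assoc flip: power_add)
  qed simp
  have pow: "char_pow \<eta> n = (\<lambda>y. \<eta> y ^ n)" if "0 < n" for n
    using that by (auto simp: char_pow_def)
  have "char_mult (char_conj (char_pow \<eta> 7)) (char_pow \<eta> 18) = (\<lambda>y. \<eta> y ^ 11)"
    by (simp add: char_mult_def char_conj_def pow cnj)
  moreover have "char_conj (char_conj \<eta>) = \<eta>" by (simp add: char_conj_def)
  ultimately show ?thesis
    by (simp add: F21_def P21_def jacobi_def P_def pow)
qed

end

theorem mainTheorem14:
  fixes eta :: "'a::{finite,field} \<Rightarrow> complex" and x :: 'a
  assumes "card (UNIV :: 'a set) mod 24 = 1"
    and "mult_char eta" and "char_order eta 24"
    and "x \<noteq> - inverse 8" and "x \<noteq> inverse 4"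
  shows "(\<forall>s. s ^ 2 = 1 - x \<longrightarrow>
            F21 (char_conj eta) (char_pow eta 7) (char_pow eta 18) (-27 * x / (1 - 4 * x) ^ 3)
            = (1 + qchar (1 - x)) / 2 *
              (char_pow eta 3 ((1 + s) ^ 2 / (4 * (1 - 4 * x)))
               + char_pow eta 3 ((1 - s) ^ 2 / (4 * (1 - 4 * x)))))
       \<and> ((\<nexists>s. s ^ 2 = 1 - x) \<longrightarrow>
            F21 (char_conj eta) (char_pow eta 7) (char_pow eta 18) (-27 * x / (1 - 4 * x) ^ 3) = 0)"
proof -
  interpret order24_char eta using assms by unfold_locales
  have "1 + 8 * x \<noteq> 0"
  proof
    assume "1 + 8 * x = 0"
    then have "8 * x = - 1" by (simp add: eq_neg_iff_add_eq_0 add.commute)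
    then have "x = - inverse 8" using eight_neq_0 by (simp add: field_simps)
    then show False using assms(4) by simp
  qed
  moreover have "1 - 4 * x \<noteq> 0"
  proof
    assume "1 - 4 * x = 0"
    then have "x = inverse 4" using four_neq_0 by (simp add: field_simps)
    then show False using assms(5) by simp
  qed
  ultimately have F: "F21 (char_conj eta) (char_pow eta 7) (char_pow eta 18) (-27 * x / (1 - 4 * x) ^ 3)
      = (\<Sum>s | s ^ 2 = 1 - x. eta ((1 - s) ^ 2 / (4 * (1 - 4 * x))) ^ 3)"
    unfolding F21_eq by (rule P_ratio)
  have pow: "char_pow eta 3 y = eta y ^ 3" for y by (simp add: char_pow_def)
  show ?thesis
  proof (intro conjI allI impI)
    fix s assume s: "s ^ 2 = 1 - x"
    have "y ^ 2 = 1 - x \<longleftrightarrow> y = s \<or> y = - s" for y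
      unfolding s[symmetric] by (rule power2_eq_iff)
    then have roots: "{y. y ^ 2 = 1 - x} = {s, - s}" by auto
    show "F21 (char_conj eta) (char_pow eta 7) (char_pow eta 18) (-27 * x / (1 - 4 * x) ^ 3)
        = (1 + qchar (1 - x)) / 2 *
          (char_pow eta 3 ((1 + s) ^ 2 / (4 * (1 - 4 * x)))
           + char_pow eta 3 ((1 - s) ^ 2 / (4 * (1 - 4 * x))))"
    \<comment> \<open>For \<open>s = 0\<close> the root set is a singleton, and the prefactor 1/2
      averages two equal terms; otherwise the prefactor is 1 and there are two roots.\<close>
    proof (cases "s = 0")
      case True
      then have "qchar (1 - x) = 0" using s by (simp add: qchar_def)
      then show ?thesis unfolding F roots pow using True by simp
    next
      case False
      then have "s \<noteq> - s"
        using two_neq_0 by (metis add_eq_0_iff mult_2 mult_eq_0_iff)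
      moreover have "qchar (1 - x) = 1" using s False by (auto simp: qchar_def)
      ultimately show ?thesis unfolding F roots pow by simp
    qed
  next
    assume "\<nexists>s. s ^ 2 = 1 - x"
    then show "F21 (char_conj eta) (char_pow eta 7) (char_pow eta 18) (-27 * x / (1 - 4 * x) ^ 3) = 0"
      unfolding F by simp
  qed
qed

end
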